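(* Let $m\ge3$, let $U\subset\mathbb{R}^m$ be a (connected, open) domain, $\vec F=(F_1,\dots,F_m)$ a $C^1$ vector field on $U$, and $u,v$ real-valued $C^2$ functions on $U$ such that $\nabla u+\vec F\neq0$ and $\nabla v+\vec F\ne0$ everywhere in $U$. Suppose $H_{\vec F}(u)\le H_{\vec F}(v)$ and $u\ge v$ in $U$, and $u=v$ at a point $p_0\in U$. For $w=v$ (or, alternatively, for $w=u$) let $N_\alpha^\perp(w)=\sum_{k=1}^m b_\alpha^k\partial_k$, $1\le\alpha\le m-1$, be an orthonormal basis in $U$ of the space perpendicular to $N_{\vec F}(w)$, and assume there exists a pair $(\alpha,\beta)$, $\alpha\ne\beta$, such that $$\sum_{k<j}(\partial_kF_j-\partial_jF_k)(b_\alpha^kb_\beta^j-b_\alpha^jb_\beta^k)\neq0$$ in $U$. Then $u\equiv v$ in $U$.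
   Context: $N_{\vec F}(u):=\frac{\nabla u+\vec F}{|\nabla u+\vec F|}$ and $H_{\vec F}(u):=\operatorname{div}N_{\vec F}(u)$ at points where $\nabla u+\vec F\ne0$ (Euclidean gradient, norm and divergence on $\mathbb{R}^m$); similarly for $v$. The basis vector fields $N^\perp_\alpha(w)$ are understood to have the regularity of $N_{\vec F}(w)$. *)

theory Defs
  imports "HOL-Analysis.Analysis"
begin

(* For open U, all notions below depend at points of U only on the values of the (total)
   functions near these points, so values outside U play no role. *)

definition partial :: "'n::finite \<Rightarrow> (real^'n \<Rightarrow> 'b::real_normed_vector) \<Rightarrow> real^'n \<Rightarrow> 'b"
  where "partial k f x = frechet_derivative f (at x) (axis k 1)"

definition C1_on :: "(real^'n::finite) set \<Rightarrow> (real^'n \<Rightarrow> 'b::real_normed_vector) \<Rightarrow> bool"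
  where "C1_on U f \<longleftrightarrow>
    (\<forall>x\<in>U. f differentiable (at x)) \<and> (\<forall>k. continuous_on U (partial k f))"

definition C2_on :: "(real^'n::finite) set \<Rightarrow> (real^'n \<Rightarrow> 'b::real_normed_vector) \<Rightarrow> bool"
  where "C2_on U f \<longleftrightarrow> C1_on U f \<and> (\<forall>k. C1_on U (partial k f))"

definition grad :: "(real^'n::finite \<Rightarrow> real) \<Rightarrow> real^'n \<Rightarrow> real^'n"
  where "grad u x = (\<chi> k. partial k u x)"

definition divergence :: "(real^'n::finite \<Rightarrow> real^'n) \<Rightarrow> real^'n \<Rightarrow> real"
  where "divergence X x = (\<Sum>k\<in>UNIV. partial k (\<lambda>y. X y $ k) x)"

(* The junk value where grad u + F vanishes is 0. *)
definition NF :: "(real^'n::finite \<Rightarrow> real^'n) \<Rightarrow> (real^'n \<Rightarrow> real) \<Rightarrow> real^'n \<Rightarrow> real^'n"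
  where "NF F u x = (1 / norm (grad u x + F x)) *\<^sub>R (grad u x + F x)"

definition HF :: "(real^'n::finite \<Rightarrow> real^'n) \<Rightarrow> (real^'n \<Rightarrow> real) \<Rightarrow> real^'n \<Rightarrow> real"
  where "HF F u = divergence (NF F u)"

definition orthonormal_basis_of_perp ::
  "(real^'n::finite) set \<Rightarrow> (real^'n \<Rightarrow> real^'n) \<Rightarrow> (nat \<Rightarrow> real^'n \<Rightarrow> real^'n) \<Rightarrow> bool"
  where "orthonormal_basis_of_perp U N b \<longleftrightarrow> (\<forall>x\<in>U.
    (\<forall>\<alpha>\<in>{1..CARD('n) - 1}. \<forall>\<beta>\<in>{1..CARD('n) - 1}.
        b \<alpha> x \<bullet> b \<beta> x = (if \<alpha> = \<beta> then 1 else 0)) \<and>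
    span ((\<lambda>\<alpha>. b \<alpha> x) ` {1..CARD('n) - 1}) = {y. y \<bullet> N x = 0})"

(* The index type is linearly ordered only so that the sum over k < j can be written;
   its summand is symmetric in (k, j), so the choice of order is immaterial. *)
definition curl_pairing ::
  "(real^'n::{finite,linorder} \<Rightarrow> real^'n::_) \<Rightarrow> (real^'n::_ \<Rightarrow> real^'n::_) \<Rightarrow> (real^'n::_ \<Rightarrow> real^'n::_) \<Rightarrow>
    real^'n::_ \<Rightarrow> real"
  where "curl_pairing F X Y x = (\<Sum>(k, j)\<in>{(k, j). k < j}.
    (partial k (\<lambda>y. F y $ j) x - partial j (\<lambda>y. F y $ k) x) *
    (X x $ k * Y x $ j - X x $ j * Y x $ k))"

end

(* Let Z = {u = v} and let theta = dw + F. Comparing u - v with a Gaussian barrier shows that every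
   exterior normal of Z (centre of a ball outside Z, seen from a point of Z on its sphere) is
   parallel to theta: the curvature difference is elliptic on the hyperplanes ker theta, and its
   first-order terms are harmless there. Hence b_alpha and b_beta are tangent to Z in the sense of
   Bony and Brezis, so curves that almost follow combinations of them stay close to Z. A small loop
   with controls p', q' ends, up to o(eps^2), at a displacement eps^2/60 [b_alpha, b_beta], so the
   bracket is tangent to Z too. But theta([b_alpha, b_beta]) = - dF(b_alpha, b_beta) is nonzero,
   so Z has no exterior normals at all and is open. *)
theory Submission
  imports Defs
begin

subsection \<open>Symmetry of the Hessian\<close>

text \<open>The obstacle is degeneracy: the curvature operator only sees second derivatives on ker
  theta, so the strong maximum principle cannot by itself force u = v. It restricts the exterior
  normals of Z, and the missing direction has to come from dF. The first-order terms are harmless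
  for this reason: at an interior minimum of u - v - eps h, with h a Gaussian of steepness k, the
  gradients of u and v differ by eps grad h. This is of order k (times eps h), while the Hessian of
  h traced over ker theta is of order k^2 unless the direction to the centre is parallel to theta. A
  large k separates the two. The basis fields are only C^1, so the bracket is reached through one
  explicit curve and first-order expansions at its base point, with a Gronwall estimate for the
  squared distance to Z, rather than through commutators of flows. Both controls return to their
  start, which cancels the displacement of order eps and leaves the bracket as leading term. At
  points of Z the gradients of u and v coincide, so theta is the same there for w = u and w =
  v.\<close>

lemma hessian_quotient_bound:
  fixes f :: "'a::euclidean_space \<Rightarrow> real"
  assumes ball: "\<And>y. norm (y - x) < d \<Longrightarrow> (f has_derivative (\<lambda>h. G y \<bullet> h)) (at y)"
    and M: "linear M"
    and G: "\<And>y. norm (y - x) < d \<Longrightarrow> norm (G y - G x - M (y - x)) \<le> e * norm (y - x)"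
    and t: "0 < t" "t * (norm a + norm b) < d" and e: "e \<ge> 0"
  shows "\<bar>f (x + t *\<^sub>R a + t *\<^sub>R b) - f (x + t *\<^sub>R a) - f (x + t *\<^sub>R b) + f x - t\<^sup>2 * (M b \<bullet> a)\<bar>
    \<le> t\<^sup>2 * (e * (2 * (norm a + norm b)\<^sup>2))"
proof -
  \<comment> \<open>The second difference is \<open>\<phi> t - \<phi> 0\<close>. The mean value
    theorem in the direction \<open>a\<close> turns it into a difference of gradients across the
    shift by \<open>t b\<close>, to which the first-order expansion of \<open>G\<close> at
    \<open>x\<close> applies.\<close>
  define \<phi> where "\<phi> s = f (x + s *\<^sub>R a + t *\<^sub>R b) - f (x + s *\<^sub>R a)" for s
  have near: "norm (x + s *\<^sub>R a + r *\<^sub>R b - x) \<le> t * (norm a + norm b)"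
    if "0 \<le> s" "s \<le> t" "0 \<le> r" "r \<le> t" for s r
  proof -
    have "norm (x + s *\<^sub>R a + r *\<^sub>R b - x) \<le> s * norm a + r * norm b"
      using norm_triangle_ineq[of "s *\<^sub>R a" "r *\<^sub>R b"] that by simp
    also have "\<dots> \<le> t * norm a + t * norm b"
      using that by (intro add_mono mult_right_mono) auto
    finally show ?thesis by (simp add: algebra_simps)
  qed
  have "\<exists>s. 0 < s \<and> s < t \<and>
      \<phi> t - \<phi> 0 = (t - 0) * ((G (x + s *\<^sub>R a + t *\<^sub>R b) - G (x + s *\<^sub>R a)) \<bullet> a)"
  proof (rule MVT2[OF t(1)])
    fix s assume s: "0 \<le> s" "s \<le> t"
    have 1: "(f has_derivative (\<lambda>h. G (x + s *\<^sub>R a + r *\<^sub>R b) \<bullet> h)) (at (x + s *\<^sub>R a + r *\<^sub>R b))"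
      if "0 \<le> r" "r \<le> t" for r
      using near[OF s that] t(2) by (intro ball) auto
    have 2: "((\<lambda>s. f (x + s *\<^sub>R a + r *\<^sub>R b)) has_derivative (\<lambda>h. G (x + s *\<^sub>R a + r *\<^sub>R b) \<bullet> (h *\<^sub>R a))) (at s)"
      if "0 \<le> r" "r \<le> t" for r
      by (rule has_derivative_compose[where g = f and f = "\<lambda>s. x + s *\<^sub>R a + r *\<^sub>R b", OF _ 1[OF that]])
         (auto intro!: derivative_eq_intros)
    show "(\<phi> has_real_derivative (G (x + s *\<^sub>R a + t *\<^sub>R b) - G (x + s *\<^sub>R a)) \<bullet> a) (at s)"
      unfolding \<phi>_def has_field_derivative_def
      by (rule has_derivative_eq_rhs)
         (use has_derivative_diff[OF 2[of t] 2[of 0]] t(1) in \<open>auto simp: algebra_simps fun_eq_iff\<close>)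
  qed
  then obtain s where s: "0 < s" "s < t"
    and eq: "\<phi> t - \<phi> 0 = t * ((G (x + s *\<^sub>R a + t *\<^sub>R b) - G (x + s *\<^sub>R a)) \<bullet> a)" by auto
  define r where "r q = G (x + s *\<^sub>R a + q *\<^sub>R b) - G x - M (s *\<^sub>R a + q *\<^sub>R b)" for q
  have r: "norm (r q) \<le> e * (t * (norm a + norm b))" if "0 \<le> q" "q \<le> t" for q
  proof -
    have "norm (r q) \<le> e * norm (x + s *\<^sub>R a + q *\<^sub>R b - x)"
      using G[of "x + s *\<^sub>R a + q *\<^sub>R b"] near[of s q] s that t(2) by (simp add: r_def add.assoc)
    also have "\<dots> \<le> e * (t * (norm a + norm b))"
      using near[of s q] s that e by (intro mult_left_mono) auto
    finally show ?thesis .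
  qed
  have "G (x + s *\<^sub>R a + t *\<^sub>R b) - G (x + s *\<^sub>R a) = t *\<^sub>R M b + (r t - r 0)"
    by (simp add: r_def linear_add[OF M] linear_cmul[OF M] linear_0[OF M])
  then have dG: "(G (x + s *\<^sub>R a + t *\<^sub>R b) - G (x + s *\<^sub>R a)) \<bullet> a = t * (M b \<bullet> a) + (r t - r 0) \<bullet> a"
    by (simp only: inner_add_left inner_scaleR_left)
  have "\<phi> t - \<phi> 0 - t\<^sup>2 * (M b \<bullet> a) = t * ((r t - r 0) \<bullet> a)"
    unfolding eq dG by (simp add: power2_eq_square algebra_simps)
  moreover have "\<bar>(r t - r 0) \<bullet> a\<bar> \<le> (e * (t * (norm a + norm b)) + e * (t * (norm a + norm b))) * (norm a + norm b)"
  proof -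
    have "\<bar>(r t - r 0) \<bullet> a\<bar> \<le> norm (r t - r 0) * norm a" by (rule Cauchy_Schwarz_ineq2)
    also have "\<dots> \<le> (e * (t * (norm a + norm b)) + e * (t * (norm a + norm b))) * (norm a + norm b)"
      using r[of t] r[of 0] t(1) e by (intro mult_mono order_trans[OF norm_triangle_ineq4] add_mono) auto
    finally show ?thesis .
  qed
  ultimately have "\<bar>\<phi> t - \<phi> 0 - t\<^sup>2 * (M b \<bullet> a)\<bar> \<le> t * ((e * (t * (norm a + norm b)) + e * (t * (norm a + norm b))) * (norm a + norm b))"
    using t(1) by (simp add: abs_mult)
  then show ?thesis
    by (simp add: \<phi>_def power2_eq_square algebra_simps)
qed

text \<open>The second difference of f along a and b does not change when a and b are swapped.
  Divided by t^2 it is within a multiple of e of both M b . a and M a . b, with e arbitrary.\<close>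

lemma hessian_symmetric:
  fixes f :: "'a::euclidean_space \<Rightarrow> real"
  assumes U: "open U" "x \<in> U"
    and f: "\<And>y. y \<in> U \<Longrightarrow> (f has_derivative (\<lambda>h. G y \<bullet> h)) (at y)"
    and G: "(G has_derivative M) (at x)"
  shows "M a \<bullet> b = M b \<bullet> a"
proof -
  have lin: "linear M" using G has_derivative_linear by blast
  define C where "C = 2 * (norm a + norm b)\<^sup>2"
  have C: "C \<ge> 0" by (simp add: C_def)
  obtain d0 where d0: "d0 > 0" "\<And>y. norm (y - x) < d0 \<Longrightarrow> y \<in> U"
    using U by (metis dist_norm openE mem_ball dist_commute subsetD)
  have est: "\<bar>M b \<bullet> a - M a \<bullet> b\<bar> \<le> 2 * (e * C)" if e: "e > 0" for e
  proof -
    obtain d1 where d1: "d1 > 0" "\<And>y. norm (y - x) < d1 \<Longrightarrow> norm (G y - G x - M (y - x)) \<le> e * norm (y - x)"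
      using G e unfolding has_derivative_at_alt by blast
    define d where "d = min d0 d1"
    \<comment> \<open>The summand 1 keeps the denominator positive even if \<open>a\<close> and
      \<open>b\<close> both vanish.\<close>
    define t where "t = d / 2 / (norm a + norm b + 1)"
    have d: "d > 0" using d0(1) d1(1) by (simp add: d_def)
    have t0: "t > 0" using d by (simp add: t_def add_nonneg_pos)
    have p: "norm a + norm b + 1 > 0" by (simp add: add_nonneg_pos)
    have "t * (norm a + norm b) < t * (norm a + norm b + 1)" using t0 by simp
    also have "\<dots> = d / 2" unfolding t_def by (rule nonzero_eq_divide_eq[THEN iffD1, OF _ refl]) (use p in simp)
    finally have t1: "t * (norm a + norm b) < d" using d by simp
    have 1: "\<bar>f (x + t *\<^sub>R a + t *\<^sub>R b) - f (x + t *\<^sub>R a) - f (x + t *\<^sub>R b) + f x - t\<^sup>2 * (M b \<bullet> a)\<bar>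
      \<le> t\<^sup>2 * (e * (2 * (norm a + norm b)\<^sup>2))"
      by (rule hessian_quotient_bound[where d = d]) (use f d0 d1 t0 t1 lin e in \<open>auto simp: d_def\<close>)
    have 2: "\<bar>f (x + t *\<^sub>R b + t *\<^sub>R a) - f (x + t *\<^sub>R b) - f (x + t *\<^sub>R a) + f x - t\<^sup>2 * (M a \<bullet> b)\<bar>
      \<le> t\<^sup>2 * (e * (2 * (norm b + norm a)\<^sup>2))"
      by (rule hessian_quotient_bound[where d = d]) (use f d0 d1 t0 t1 lin e in \<open>auto simp: d_def add.commute\<close>)
    have eq: "x + t *\<^sub>R b + t *\<^sub>R a = x + t *\<^sub>R a + t *\<^sub>R b" "norm b + norm a = norm a + norm b" by simp_all
    have "\<bar>t\<^sup>2 * (M b \<bullet> a) - t\<^sup>2 * (M a \<bullet> b)\<bar> \<le> t\<^sup>2 * (e * C) + t\<^sup>2 * (e * C)"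
      using 1 2[unfolded eq] unfolding C_def by linarith
    moreover have "t\<^sup>2 * (M b \<bullet> a) - t\<^sup>2 * (M a \<bullet> b) = t\<^sup>2 * (M b \<bullet> a - M a \<bullet> b)"
      by (simp add: algebra_simps)
    ultimately have "t\<^sup>2 * \<bar>M b \<bullet> a - M a \<bullet> b\<bar> \<le> t\<^sup>2 * (2 * (e * C))"
      by (simp add: abs_mult mult_ac)
    then show ?thesis using t0 by simp
  qed
  have "\<bar>M b \<bullet> a - M a \<bullet> b\<bar> \<le> 0"
  proof (rule field_le_epsilon)
    fix e :: real assume e: "e > 0"
    have "\<bar>M b \<bullet> a - M a \<bullet> b\<bar> \<le> 2 * (e / (2 * (C + 1)) * C)" using e C by (intro est) simp
    also have "\<dots> \<le> e" using e C by (simp add: field_simps)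
    finally show "\<bar>M b \<bullet> a - M a \<bullet> b\<bar> \<le> 0 + e" by simp
  qed
  then show ?thesis by simp
qed

subsection \<open>Invariance of closed sets under tangent fields\<close>

text \<open>Meant for squared distances to a closed set, which may fail to be differentiable: the
  differential inequality is asked only of a function touching f from above. At the last time where
  f stays below a strict supersolution such a function would fall below it to the right, carrying f
  along.\<close>

lemma gronwall_upper_contact:
  fixes f :: "real \<Rightarrow> real"
  assumes cont: "continuous_on {0..1} f" and f0: "f 0 \<le> 0" and c: "c \<ge> 0" and a: "a \<ge> 0"
    and contact: "\<And>t. 0 \<le> t \<Longrightarrow> t < 1 \<Longrightarrow> \<exists>g g'. g t = f t \<and> (\<forall>s\<in>{0..1}. f s \<le> g s) \<and>
      (g has_real_derivative g') (at t within {0..1}) \<and> g' \<le> a * f t + c"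
  shows "f 1 \<le> c * exp (a + 1)"
proof -
  have main: "f 1 \<le> c' * exp (a + 1)" if c': "c' > c" for c'
  proof (rule ccontr)
    assume neg: "\<not> ?thesis"
    \<comment> \<open>The rate \<open>a + 1\<close> together with \<open>c' > c\<close> makes
      \<open>y\<close> a strict supersolution: \<open>y \<ge> c' > c\<close> gives
      \<open>a * y + c < (a + 1) * y\<close>.\<close>
    define y where "y t = c' * exp ((a + 1) * t)" for t
    have y': "(y has_real_derivative (a + 1) * y t) (at t within {0..1})" for t
      unfolding y_def by (auto intro!: derivative_eq_intros)
    have ygt: "y t \<ge> c'" if "t \<ge> 0" for t
      using that a c c' by (simp add: y_def)
    have cy: "continuous_on {0..1} y" unfolding y_def by (intro continuous_intros)
    define S where "S = {t\<in>{0..1}. f t - y t \<le> 0}"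
    have "closed S" unfolding S_def
      by (rule continuous_on_closed_Collect_le) (auto intro!: continuous_intros cont cy)
    then have S: "compact S" unfolding S_def
      by (metis (no_types, lifting) bounded_closed_interval bounded_subset compact_eq_bounded_closed mem_Collect_eq subsetI)
    have "0 \<in> S" using f0 c c' by (simp add: S_def y_def)
    then obtain t where t: "t \<in> S" "\<And>s. s \<in> S \<Longrightarrow> s \<le> t"
      using compact_attains_sup[OF S] by auto
    have "1 \<notin> S" using neg by (simp add: S_def y_def)
    then have t1: "0 \<le> t" "t < 1" "f t \<le> y t" using t(1) unfolding S_def by (auto simp: less_le)
    obtain g g' where g: "g t = f t" "\<And>s. s \<in> {0..1} \<Longrightarrow> f s \<le> g s"
      "(g has_real_derivative g') (at t within {0..1})" "g' \<le> a * f t + c"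
      using contact[OF t1(1,2)] by blast
    have above: "f s > y s" if "t < s" "s \<le> 1" for s
      using t(2)[of s] that t1 by (force simp: S_def)
    have "f t \<ge> y t"
    proof (rule ccontr)
      assume "\<not> f t \<ge> y t"
      then have "\<forall>\<^sub>F s in at t within {0..1}. f s - y s < 0"
        using continuous_on_diff[OF cont cy] t1
        by (intro order_tendstoD(2)[where y = "f t - y t"]) (auto simp: continuous_on_def)
      then obtain e where e: "e > 0" "\<And>s. s \<in> {0..1} \<Longrightarrow> s \<noteq> t \<Longrightarrow> dist s t < e \<Longrightarrow> f s - y s < 0"
        unfolding eventually_at by blast
      define s where "s = t + min (e/2) (1 - t)"
      have "t < s" "s \<le> 1" "dist s t < e" using e(1) t1 by (auto simp: s_def dist_real_def min_def)
      then show False using e(2)[of s] above[of s] t1 by simp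
    qed
    then have fy: "f t = y t" using t1 by simp
    have "g' < (a + 1) * y t"
    proof -
      have "g' \<le> a * y t + c" using g(4) fy by simp
      also have "\<dots> < a * y t + y t" using ygt[OF t1(1)] c' by simp
      finally show ?thesis by (simp add: algebra_simps)
    qed
    moreover have "((\<lambda>s. g s - y s) has_real_derivative g' - (a + 1) * y t) (at t within {0..1})"
      using g(3) y' by (intro derivative_intros)
    ultimately obtain d where d: "d > 0"
      "\<And>h. h > 0 \<Longrightarrow> t + h \<in> {0..1} \<Longrightarrow> h < d \<Longrightarrow> g t - y t > g (t + h) - y (t + h)"
      using has_real_derivative_neg_dec_right[of "\<lambda>s. g s - y s" "g' - (a + 1) * y t" t "{0..1}"] by auto
    define h where "h = min (d/2) (1 - t)"
    have h: "h > 0" "t + h \<in> {0..1}" "h < d" using d(1) t1 by (auto simp: h_def)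
    have "g (t + h) < y (t + h)" using d(2)[OF h] g(1) fy by simp
    moreover have "f (t + h) > y (t + h)" using h by (intro above) auto
    ultimately show False using g(2)[OF h(2)] by simp
  qed
  show ?thesis
  proof (rule field_le_epsilon)
    fix e :: real assume e: "e > 0"
    have "f 1 \<le> (c + e / exp (a + 1)) * exp (a + 1)" using e by (intro main) simp
    also have "\<dots> = c * exp (a + 1) + e" by (simp add: field_simps)
    finally show "f 1 \<le> c * exp (a + 1) + e" .
  qed
qed

definition proximal_normal :: "'a::euclidean_space set \<Rightarrow> 'a set \<Rightarrow> 'a \<Rightarrow> 'a \<Rightarrow> bool"
  where "proximal_normal U Z x \<nu> \<longleftrightarrow>
    x \<in> Z \<and> cball (x + \<nu>) (norm \<nu>) \<subseteq> U \<and> ball (x + \<nu>) (norm \<nu>) \<inter> Z = {}"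

lemma compact_Int_cball:
  fixes Z :: "'a::euclidean_space set"
  assumes "closedin (top_of_set U) Z" "cball z R \<subseteq> U"
  shows "compact (Z \<inter> cball z R)"
proof -
  obtain T where T: "closed T" "Z = U \<inter> T"
    using assms(1) by (auto simp: closedin_closed)
  then have "Z \<inter> cball z R = T \<inter> cball z R" using assms(2) by auto
  then show ?thesis using T(1) by (simp add: closed_Int_compact)
qed

text \<open>The halved radius makes the point nearest within \<open>cball z R\<close> nearest in all
  of Z: the point z bounds the distance from y by R / 2, so the ball about y through x stays inside
  \<open>cball z R\<close>.\<close>

lemma nearest_point_proximal_normal:
  fixes Z :: "'a::euclidean_space set"
  assumes Z: "closedin (top_of_set U) Z" "z \<in> Z" and R: "cball z R \<subseteq> U" and y: "y \<in> ball z (R / 2)"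
  obtains x where "x \<in> Z \<inter> cball z R" "infdist y (Z \<inter> cball z R) = dist y x"
    "proximal_normal U Z x (y - x)"
proof -
  have yz: "dist z y < R / 2" using y by simp
  have z: "z \<in> Z \<inter> cball z R" using Z(2) yz zero_le_dist[of z y] by (auto simp del: zero_le_dist)
  obtain x where x: "x \<in> Z \<inter> cball z R" "infdist y (Z \<inter> cball z R) = dist y x"
    using infdist_attains_inf[of "Z \<inter> cball z R" y] compact_imp_closed[OF compact_Int_cball[OF Z(1) R]] z
    by blast
  have le: "dist y x \<le> dist y q" if "q \<in> Z \<inter> cball z R" for q
    using infdist_le[OF that, of y] x(2) by simp
  have yx: "dist y x < R / 2" using le[OF z] yz by (simp add: dist_commute)
  have sub: "q \<in> cball z R" if "q \<in> cball y (dist y x)" for q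
    using that yx yz dist_triangle[of z q y] by simp
  have "proximal_normal U Z x (y - x)"
    unfolding proximal_normal_def
  proof (intro conjI)
    show "x \<in> Z" using x by simp
    show "cball (x + (y - x)) (norm (y - x)) \<subseteq> U" using sub R by (auto simp: dist_norm)
    show "ball (x + (y - x)) (norm (y - x)) \<inter> Z = {}"
    proof -
      have "q \<notin> Z" if "q \<in> ball y (dist y x)" for q
        using le[of q] sub[of q] that by auto
      then show ?thesis by (auto simp: dist_norm)
    qed
  qed
  with x that show ?thesis by blast
qed

text \<open>At a nearest point x of Z, the vector from x to the curve is a proximal normal, hence
  orthogonal to V at x, and V at the curve differs from that by at most L times the distance.
  Freezing x gives a smooth function touching the squared distance from above, so Gronwall
  applies.\<close>

lemma almost_integral_curve_near:
  fixes Z :: "'a::euclidean_space set"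
  assumes Z: "closedin (top_of_set U) Z" "z \<in> Z" and R: "cball z R \<subseteq> U"
    and L: "L \<ge> 0"
    and lip: "\<And>t x y. t \<in> {0..1} \<Longrightarrow> x \<in> cball z R \<Longrightarrow> y \<in> cball z R \<Longrightarrow>
      norm (V t x - V t y) \<le> L * norm (x - y)"
    and tangent: "\<And>t x \<nu>. t \<in> {0..1} \<Longrightarrow> proximal_normal U Z x \<nu> \<Longrightarrow> V t x \<bullet> \<nu> = 0"
    and \<gamma>: "\<And>t. t \<in> {0..1} \<Longrightarrow> (\<gamma> has_vector_derivative \<gamma>' t) (at t within {0..1})"
    and inside: "\<And>t. t \<in> {0..1} \<Longrightarrow> \<gamma> t \<in> ball z (R / 2)"
    and err: "\<And>t. t \<in> {0..1} \<Longrightarrow> norm (\<gamma>' t - V t (\<gamma> t)) \<le> \<eta>"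
    and start: "\<gamma> 0 = z"
  shows "\<exists>x\<in>Z. norm (\<gamma> 1 - x) \<le> \<eta> * exp (L + 1)"
proof -
  define S where "S = Z \<inter> cball z R"
  define f where "f t = (infdist (\<gamma> t) S)\<^sup>2" for t
  have \<eta>: "\<eta> \<ge> 0" using err[of 0] norm_ge_zero[of "\<gamma>' 0 - V 0 (\<gamma> 0)"] by (simp del: norm_ge_zero)
  have R0: "R > 0" using inside[of 0] start by auto
  have "continuous_on {0..1} \<gamma>"
    using \<gamma> has_vector_derivative_continuous by (fastforce simp: continuous_on_eq_continuous_within)
  then have cont: "continuous_on {0..1} f" unfolding f_def by (intro continuous_intros)
  \<comment> \<open>The rate \<open>2 * L + 1\<close> comes from absorbing the mixed term, 2
    \<delta> \<eta> \<le> \<delta>^2 + \<eta>^2. The exponent is then 2 (L + 1), and the square root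
    yields the claimed factor.\<close>
  have "f 1 \<le> \<eta>\<^sup>2 * exp ((2 * L + 1) + 1)"
  proof (rule gronwall_upper_contact[OF cont])
    show "f 0 \<le> 0" using Z(2) R0 by (simp add: f_def S_def start)
    show "0 \<le> 2 * L + 1" using L by simp
    fix t :: real assume t: "0 \<le> t" "t < 1"
    obtain x where x: "x \<in> S" "infdist (\<gamma> t) S = dist (\<gamma> t) x" "proximal_normal U Z x (\<gamma> t - x)"
      using nearest_point_proximal_normal[OF Z R inside[of t]] t unfolding S_def by auto
    define \<delta> where "\<delta> = norm (\<gamma> t - x)"
    have xR: "x \<in> cball z R" "\<gamma> t \<in> cball z R" using x(1) inside[of t] t R0 by (auto simp: S_def)
    have "(\<gamma> t - x) \<bullet> \<gamma>' t = (\<gamma> t - x) \<bullet> (V t (\<gamma> t) - V t x) + (\<gamma> t - x) \<bullet> (\<gamma>' t - V t (\<gamma> t))"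
      using tangent[OF _ x(3), of t] t by (simp add: inner_diff_right inner_commute)
    also have "\<dots> \<le> \<delta> * (L * \<delta>) + \<delta> * \<eta>"
      unfolding \<delta>_def using lip[of t "\<gamma> t" x] xR err[of t] t
      by (intro add_mono order_trans[OF norm_cauchy_schwarz] mult_left_mono) auto
    finally have "2 * ((\<gamma> t - x) \<bullet> \<gamma>' t) \<le> 2 * L * \<delta>\<^sup>2 + 2 * \<delta> * \<eta>"
      by (simp add: power2_eq_square algebra_simps)
    also have "\<dots> \<le> 2 * L * \<delta>\<^sup>2 + (\<delta>\<^sup>2 + \<eta>\<^sup>2)"
      using sum_squares_bound[of \<delta> \<eta>] by simp
    also have "\<dots> = (2 * L + 1) * f t + \<eta>\<^sup>2"
      using x(2) by (simp add: f_def \<delta>_def dist_norm algebra_simps)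
    finally have le: "2 * ((\<gamma> t - x) \<bullet> \<gamma>' t) \<le> (2 * L + 1) * f t + \<eta>\<^sup>2" .
    have "((\<lambda>s. (\<gamma> s - x) \<bullet> (\<gamma> s - x)) has_vector_derivative 2 * ((\<gamma> t - x) \<bullet> \<gamma>' t)) (at t within {0..1})"
      using \<gamma>[of t] t unfolding has_vector_derivative_def
      by (auto intro!: derivative_eq_intros simp: inner_commute algebra_simps)
    moreover have "f s \<le> (\<gamma> s - x) \<bullet> (\<gamma> s - x)" for s
      using infdist_le[OF x(1), of "\<gamma> s"]
      by (simp add: f_def dot_square_norm dist_norm infdist_nonneg power_mono)
    moreover have "f t = (\<gamma> t - x) \<bullet> (\<gamma> t - x)"
      using x(2) by (simp add: f_def dot_square_norm dist_norm)
    ultimately show "\<exists>g g'. g t = f t \<and> (\<forall>s\<in>{0..1}. f s \<le> g s) \<and>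
      (g has_real_derivative g') (at t within {0..1}) \<and> g' \<le> (2 * L + 1) * f t + \<eta>\<^sup>2"
      using le by (intro exI[of _ "\<lambda>s. (\<gamma> s - x) \<bullet> (\<gamma> s - x)"] exI[of _ "2 * ((\<gamma> t - x) \<bullet> \<gamma>' t)"])
        (auto simp: has_real_derivative_iff_has_vector_derivative)
  qed simp
  also have "\<dots> = (\<eta> * exp (L + 1))\<^sup>2"
    by (simp add: power_mult_distrib exp_double[symmetric] algebra_simps)
  finally have "infdist (\<gamma> 1) S \<le> \<eta> * exp (L + 1)"
    unfolding f_def by (rule power2_le_imp_le) (use \<eta> in simp)
  moreover obtain x where "x \<in> S" "infdist (\<gamma> 1) S = dist (\<gamma> 1) x"
    using nearest_point_proximal_normal[OF Z R inside[of 1]] unfolding S_def by auto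
  ultimately show ?thesis by (auto simp: S_def dist_norm)
qed

text \<open>The loop is \<open>z + \<epsilon> (p X + q Y) + \<epsilon>\<^sup>2 W\<close> for the closed polynomial curve \<open>(p, q)\<close>; the correction \<open>W\<close>
  makes its velocity \<open>\<epsilon> (p' X + q' Y)\<close> up to \<open>o(\<epsilon>\<^sup>2)\<close>, and \<open>s\<close> is the primitive of \<open>q' p\<close>, so that
  \<open>s 1 = 1/60\<close> is the area enclosed by \<open>(p, q)\<close>.\<close>

lemma bracket_proximal_normal_nonpos:
  fixes X Y :: "'a::euclidean_space \<Rightarrow> 'a"
  assumes Z: "closedin (top_of_set U) Z" and normal: "proximal_normal U Z z \<nu>"
    and X_tan: "\<And>x \<nu>. proximal_normal U Z x \<nu> \<Longrightarrow> X x \<bullet> \<nu> = 0"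
    and Y_tan: "\<And>x \<nu>. proximal_normal U Z x \<nu> \<Longrightarrow> Y x \<bullet> \<nu> = 0"
    and X_diff: "(X has_derivative A) (at z)" and Y_diff: "(Y has_derivative B) (at z)"
    and R: "R > 0" "cball z R \<subseteq> U" and L: "L \<ge> 0"
    and X_lip: "\<And>x y. x \<in> cball z R \<Longrightarrow> y \<in> cball z R \<Longrightarrow> norm (X x - X y) \<le> L * norm (x - y)"
    and Y_lip: "\<And>x y. x \<in> cball z R \<Longrightarrow> y \<in> cball z R \<Longrightarrow> norm (Y x - Y y) \<le> L * norm (x - y)"
  shows "(B (X z) - A (Y z)) \<bullet> \<nu> \<le> 0"
proof -
  \<comment> \<open>Both controls vanish at 0 and 1 and have speed at most 1 there and between. Here
    q' p = 2 t^2 - 5 t^3 + 3 t^4, and 2/3 - 5/4 + 3/5 = 1/60.\<close>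
  define p q p' q' s :: "real \<Rightarrow> real"
    where "p t = t - t\<^sup>2" and "q t = t\<^sup>2 - t ^ 3" and "p' t = 1 - 2 * t" and "q' t = 2 * t - 3 * t\<^sup>2"
      and "s t = 2 / 3 * t ^ 3 - 5 / 4 * t ^ 4 + 3 / 5 * t ^ 5" for t
  define l where "l t = p t *\<^sub>R X z + q t *\<^sub>R Y z" for t
  \<comment> \<open>The four scalar factors are primitives of p' p, q' q, p' q and q' p, so W' = p'
    A l + q' B l, the linear variation of p' X + q' Y along l. At t = 1 only the two terms with
    \<open>s\<close> survive, with opposite signs, and W 1 = V / 60.\<close>
  define W where "W t = ((p t)\<^sup>2 / 2) *\<^sub>R A (X z) + ((q t)\<^sup>2 / 2) *\<^sub>R B (Y z)
    + (p t * q t - s t) *\<^sub>R A (Y z) + s t *\<^sub>R B (X z)" for t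
  define V where "V = B (X z) - A (Y z)"
  have lA: "linear A" and lB: "linear B"
    using X_diff Y_diff has_derivative_linear by blast+
  have pd: "(p has_real_derivative p' t) (at t within T)" "(q has_real_derivative q' t) (at t within T)"
    "(s has_real_derivative q' t * p t) (at t within T)" for t T
    unfolding p_def q_def p'_def q'_def s_def
    by (auto intro!: derivative_eq_intros simp: field_simps power2_eq_square power3_eq_cube eval_nat_numeral)
  have dl: "(l has_vector_derivative p' t *\<^sub>R X z + q' t *\<^sub>R Y z) (at t within T)" for t T
    unfolding l_def by (auto intro!: derivative_eq_intros pd)
  have dW: "(W has_vector_derivative p' t *\<^sub>R A (l t) + q' t *\<^sub>R B (l t)) (at t within T)" for t T
  proof -
    have 1: "((\<lambda>t. (p t)\<^sup>2 / 2) has_real_derivative p' t * p t) (at t within T)"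
      "((\<lambda>t. (q t)\<^sup>2 / 2) has_real_derivative q' t * q t) (at t within T)"
      "((\<lambda>t. p t * q t - s t) has_real_derivative p' t * q t) (at t within T)"
      by (auto intro!: derivative_eq_intros pd simp: algebra_simps)
    show ?thesis unfolding W_def
      by (rule derivative_eq_intros 1 pd refl)+
         (simp add: l_def linear_add[OF lA] linear_add[OF lB] linear_cmul[OF lA] linear_cmul[OF lB] algebra_simps)
  qed
  have "bounded (l ` {0..1})" "bounded (W ` {0..1})"
    using has_vector_derivative_continuous[OF dl] has_vector_derivative_continuous[OF dW]
    by (auto intro!: compact_imp_bounded compact_continuous_image simp: continuous_on_eq_continuous_within)
  then obtain c w where c: "c > 0" "\<And>t. t \<in> {0..1} \<Longrightarrow> norm (l t) \<le> c"
    and w: "w > 0" "\<And>t. t \<in> {0..1} \<Longrightarrow> norm (W t) \<le> w"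
    by (auto simp: bounded_pos)
  obtain KA KB where KA: "KA > 0" "\<And>h. norm (A h) \<le> KA * norm h" and KB: "KB > 0" "\<And>h. norm (B h) \<le> KB * norm h"
    using linear_bounded_pos[OF lA] linear_bounded_pos[OF lB] by (metis mult.commute)
  define K where "K = KA + KB"
  have K: "norm (A h) \<le> K * norm h" "norm (B h) \<le> K * norm h" for h
    using KA(2)[of h] KB(2)[of h] KA(1) KB(1) by (auto simp: K_def distrib_right add_increasing add_increasing2)
  have K0: "K > 0" using KA KB by (simp add: K_def)
  define D where "D = c + w"
  have D0: "D > 0" using c w by (simp add: D_def)
  define E where "E = exp (2 * L + 1)"
  \<comment> \<open>Bounds the displacement of the endpoint in Z divided by \<epsilon>^2, valid once
    \<open>e\<close> and \<open>\<epsilon>\<close> are at most 1. \<open>D\<close> bounds the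
    displacement of the loop divided by \<epsilon>, and \<open>E\<close> is the Gronwall factor for
    the Lipschitz constant 2 L.\<close>
  define Q where "Q = norm V + 2 * (D + K * w) * E"
  have E0: "E > 0" by (simp add: E_def)
  \<comment> \<open>Already divided by \<epsilon>^2. The accuracy \<open>e\<close> of the
    linearisations is kept apart from the size \<open>\<epsilon>\<close> of the loop, since
    \<epsilon> has to tend to 0 first, with e fixed.\<close>
  have step: "(V \<bullet> \<nu>) / 30 \<le> 4 * ((e * D + \<epsilon> * (K * w)) * E * norm \<nu>) + \<epsilon>\<^sup>2 * Q\<^sup>2"
    if e: "0 < e" "e \<le> 1" and \<epsilon>: "0 < \<epsilon>" "\<epsilon> \<le> 1" "\<epsilon> * D < R / 2"
      and Xe: "\<And>h. norm h \<le> \<epsilon> * D \<Longrightarrow> norm (X (z + h) - X z - A h) \<le> e * norm h"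
      and Ye: "\<And>h. norm h \<le> \<epsilon> * D \<Longrightarrow> norm (Y (z + h) - Y z - B h) \<le> e * norm h" for e \<epsilon>
  proof -
    define \<gamma> where "\<gamma> t = z + (\<epsilon> *\<^sub>R l t + \<epsilon>\<^sup>2 *\<^sub>R W t)" for t
    define \<gamma>' where "\<gamma>' t = \<epsilon> *\<^sub>R (p' t *\<^sub>R X z + q' t *\<^sub>R Y z)
      + \<epsilon>\<^sup>2 *\<^sub>R (p' t *\<^sub>R A (l t) + q' t *\<^sub>R B (l t))" for t
    \<comment> \<open>Velocity error: one factor \<epsilon> from the controls, the factor 2 from the
      two fields, and for each field a linearisation error of \<epsilon> times the bracketed
      sum.\<close>
    define \<eta> where "\<eta> = 2 * \<epsilon>\<^sup>2 * (e * D + \<epsilon> * (K * w))"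
    have h: "norm (\<epsilon> *\<^sub>R l t + \<epsilon>\<^sup>2 *\<^sub>R W t) \<le> \<epsilon> * D" if "t \<in> {0..1}" for t
    proof -
      have "norm (\<epsilon> *\<^sub>R l t + \<epsilon>\<^sup>2 *\<^sub>R W t) \<le> \<epsilon> * norm (l t) + \<epsilon>\<^sup>2 * norm (W t)"
        using norm_triangle_ineq[of "\<epsilon> *\<^sub>R l t" "\<epsilon>\<^sup>2 *\<^sub>R W t"] \<epsilon> by simp
      also have "\<dots> \<le> \<epsilon> * c + \<epsilon> * w"
        using c(2)[OF that] w \<epsilon> w(2)[OF that]
        by (intro add_mono mult_left_mono mult_mono) (auto simp: power2_eq_square mult_left_le)
      finally show ?thesis by (simp add: D_def algebra_simps)
    qed
    have lin_err: "norm (X0 + \<epsilon> *\<^sub>R M (l t) - X' (\<gamma> t)) \<le> \<epsilon> * (e * D + \<epsilon> * (K * w))"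
      if t: "t \<in> {0..1}" and M: "linear M" "\<And>h. norm (M h) \<le> K * norm h"
        and X': "\<And>h. norm h \<le> \<epsilon> * D \<Longrightarrow> norm (X' (z + h) - X0 - M h) \<le> e * norm h"
      for t M X0 and X' :: "'a \<Rightarrow> 'a"
    proof -
      let ?h = "\<epsilon> *\<^sub>R l t + \<epsilon>\<^sup>2 *\<^sub>R W t"
      have "X0 + \<epsilon> *\<^sub>R M (l t) - X' (\<gamma> t) = - (X' (z + ?h) - X0 - M ?h) - \<epsilon>\<^sup>2 *\<^sub>R M (W t)"
        by (simp add: \<gamma>_def linear_add[OF M(1)] linear_cmul[OF M(1)])
      also have "norm \<dots> \<le> norm (X' (z + ?h) - X0 - M ?h) + norm (\<epsilon>\<^sup>2 *\<^sub>R M (W t))"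
        using norm_triangle_ineq4[of "- (X' (z + ?h) - X0 - M ?h)"] by (simp only: norm_minus_cancel)
      also have "\<dots> \<le> e * (\<epsilon> * D) + \<epsilon>\<^sup>2 * (K * w)"
      proof (rule add_mono)
        show "norm (X' (z + ?h) - X0 - M ?h) \<le> e * (\<epsilon> * D)"
          using X'[OF h[OF t]] h[OF t] e by (meson mult_left_mono order_trans less_imp_le)
        have "norm (M (W t)) \<le> K * w"
          using M(2)[of "W t"] w(2)[OF t] K0 by (meson mult_left_mono order_trans less_imp_le)
        then show "norm (\<epsilon>\<^sup>2 *\<^sub>R M (W t)) \<le> \<epsilon>\<^sup>2 * (K * w)" by (simp add: mult_left_mono)
      qed
      finally show ?thesis by (simp add: power2_eq_square algebra_simps)
    qed
    have p'1: "\<bar>p' t\<bar> \<le> 1" "\<bar>q' t\<bar> \<le> 1" if "t \<in> {0..1}" for t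
    proof -
      have t: "0 \<le> t" "t \<le> 1" using that by auto
      then show "\<bar>p' t\<bar> \<le> 1" by (auto simp: p'_def)
      have "t\<^sup>2 \<le> t" using t by (simp add: power2_eq_square mult_left_le)
      \<comment> \<open>The square gives q' \<le> 1/3, and the product equals 1 + q'.\<close>
      moreover have "0 \<le> (3 * t - 1)\<^sup>2" "0 \<le> (1 - t) * (1 + 3 * t)" using t by auto
      ultimately show "\<bar>q' t\<bar> \<le> 1" by (auto simp: q'_def abs_le_iff power2_eq_square algebra_simps)
    qed
    have "\<exists>x\<in>Z. norm (\<gamma> 1 - x) \<le> \<eta> * exp (2 * L + 1)"
    proof (rule almost_integral_curve_near[where V = "\<lambda>t x. \<epsilon> *\<^sub>R (p' t *\<^sub>R X x + q' t *\<^sub>R Y x)"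
          and \<gamma>' = \<gamma>' and R = R, OF Z])
      show "z \<in> Z" using normal by (simp add: proximal_normal_def)
      show "0 \<le> 2 * L" "cball z R \<subseteq> U" using L R by auto
      show "\<gamma> 0 = z" by (simp add: \<gamma>_def l_def W_def p_def q_def s_def)
      fix t :: real assume t: "t \<in> {0..1}"
      show "\<epsilon> *\<^sub>R (p' t *\<^sub>R X x + q' t *\<^sub>R Y x) \<bullet> \<nu> = 0" if "proximal_normal U Z x \<nu>" for x \<nu>
        using X_tan[OF that] Y_tan[OF that] by (simp add: inner_add_left)
      show "(\<gamma> has_vector_derivative \<gamma>' t) (at t within {0..1})"
        unfolding \<gamma>_def \<gamma>'_def by (auto intro!: derivative_eq_intros dl dW)
      have "dist (\<gamma> t) z = norm (\<epsilon> *\<^sub>R l t + \<epsilon>\<^sup>2 *\<^sub>R W t)" by (simp add: \<gamma>_def dist_norm)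
      then show "\<gamma> t \<in> ball z (R / 2)" using h[OF t] \<epsilon>(3) by (simp add: dist_commute)
      have two: "norm (\<epsilon> *\<^sub>R (p' t *\<^sub>R a + q' t *\<^sub>R b)) \<le> \<epsilon> * (m + m)"
        if "norm a \<le> m" "norm b \<le> m" for a b :: 'a and m
      proof -
        have "norm (p' t *\<^sub>R a + q' t *\<^sub>R b) \<le> \<bar>p' t\<bar> * norm a + \<bar>q' t\<bar> * norm b"
          using norm_triangle_ineq[of "p' t *\<^sub>R a" "q' t *\<^sub>R b"] by simp
        also have "\<dots> \<le> 1 * m + 1 * m"
          using p'1[OF t] that by (intro add_mono mult_mono) auto
        finally show ?thesis using \<epsilon> by simp
      qed
      show "norm (\<epsilon> *\<^sub>R (p' t *\<^sub>R X x + q' t *\<^sub>R Y x) - \<epsilon> *\<^sub>R (p' t *\<^sub>R X y + q' t *\<^sub>R Y y)) \<le> 2 * L * norm (x - y)"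
        if "x \<in> cball z R" "y \<in> cball z R" for x y
      proof -
        have "\<epsilon> *\<^sub>R (p' t *\<^sub>R X x + q' t *\<^sub>R Y x) - \<epsilon> *\<^sub>R (p' t *\<^sub>R X y + q' t *\<^sub>R Y y)
            = \<epsilon> *\<^sub>R (p' t *\<^sub>R (X x - X y) + q' t *\<^sub>R (Y x - Y y))" by (simp add: algebra_simps)
        also have "norm \<dots> \<le> \<epsilon> * (L * norm (x - y) + L * norm (x - y))"
          by (rule two[OF X_lip[OF that] Y_lip[OF that]])
        also have "\<dots> \<le> 1 * (L * norm (x - y) + L * norm (x - y))"
          using \<epsilon> L by (intro mult_right_mono) auto
        finally show ?thesis by simp
      qed
      have "\<gamma>' t - \<epsilon> *\<^sub>R (p' t *\<^sub>R X (\<gamma> t) + q' t *\<^sub>R Y (\<gamma> t)) =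
        \<epsilon> *\<^sub>R (p' t *\<^sub>R (X z + \<epsilon> *\<^sub>R A (l t) - X (\<gamma> t)) + q' t *\<^sub>R (Y z + \<epsilon> *\<^sub>R B (l t) - Y (\<gamma> t)))"
        by (simp add: \<gamma>'_def power2_eq_square algebra_simps)
      also have "norm \<dots> \<le> \<epsilon> * (\<epsilon> * (e * D + \<epsilon> * (K * w)) + \<epsilon> * (e * D + \<epsilon> * (K * w)))"
        by (rule two[OF lin_err[OF t lA K(1) Xe] lin_err[OF t lB K(2) Ye]])
      finally show "norm (\<gamma>' t - \<epsilon> *\<^sub>R (p' t *\<^sub>R X (\<gamma> t) + q' t *\<^sub>R Y (\<gamma> t))) \<le> \<eta>"
        by (simp add: \<eta>_def power2_eq_square algebra_simps)
    qed
    then obtain x where x: "x \<in> Z" "norm (\<gamma> 1 - x) \<le> \<eta> * E" unfolding E_def by blast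
    define \<rho> where "\<rho> = x - \<gamma> 1"
    have \<gamma>1: "\<gamma> 1 = z + (\<epsilon>\<^sup>2 / 60) *\<^sub>R V"
      by (simp add: \<gamma>_def l_def W_def p_def q_def s_def V_def algebra_simps)
    have xz: "x - z = (\<epsilon>\<^sup>2 / 60) *\<^sub>R V + \<rho>" by (simp add: \<rho>_def \<gamma>1)
    have \<rho>: "norm \<rho> \<le> \<eta> * E" using x(2) by (simp add: \<rho>_def norm_minus_commute)
    \<comment> \<open>Staying outside the ball means 2 (x - z) . \<nu> \<le> |x - z|^2. The right
      side is of order \<epsilon>^4, so the part of x - z of order \<epsilon>^2 cannot point into
      the ball.\<close>
    have "x \<notin> ball (z + \<nu>) (norm \<nu>)" using normal x(1) by (auto simp: proximal_normal_def)
    then have "norm \<nu> \<le> norm ((x - z) - \<nu>)"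
      by (simp add: dist_norm norm_minus_commute algebra_simps)
    then have "(norm \<nu>)\<^sup>2 \<le> (norm ((x - z) - \<nu>))\<^sup>2" by (intro power_mono) auto
    then have "2 * ((x - z) \<bullet> \<nu>) \<le> (norm (x - z))\<^sup>2"
      by (simp add: power2_norm_eq_inner inner_diff_left inner_diff_right inner_commute)
    moreover have "(x - z) \<bullet> \<nu> \<ge> \<epsilon>\<^sup>2 / 60 * (V \<bullet> \<nu>) - \<eta> * E * norm \<nu>"
    proof -
      have "\<bar>\<rho> \<bullet> \<nu>\<bar> \<le> \<eta> * E * norm \<nu>"
        using \<rho> by (intro order_trans[OF Cauchy_Schwarz_ineq2] mult_right_mono) auto
      then show ?thesis unfolding xz by (simp add: inner_add_left)
    qed
    moreover have "norm (x - z) \<le> \<epsilon>\<^sup>2 * Q"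
    proof -
      have "norm (x - z) \<le> \<epsilon>\<^sup>2 / 60 * norm V + \<eta> * E"
        unfolding xz using \<rho> by (intro order_trans[OF norm_triangle_ineq] add_mono) auto
      also have "\<dots> \<le> \<epsilon>\<^sup>2 * norm V + \<epsilon>\<^sup>2 * (2 * (D + K * w) * E)"
      proof (rule add_mono)
        have "\<eta> \<le> 2 * \<epsilon>\<^sup>2 * (1 * D + 1 * (K * w))"
          unfolding \<eta>_def using e \<epsilon> D0 K0 w by (intro mult_left_mono add_mono mult_right_mono) auto
        then have "\<eta> * E \<le> 2 * \<epsilon>\<^sup>2 * (1 * D + 1 * (K * w)) * E"
          using E0 by (intro mult_right_mono) auto
        then show "\<eta> * E \<le> \<epsilon>\<^sup>2 * (2 * (D + K * w) * E)" by (simp add: algebra_simps)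
      qed (simp add: divide_le_eq mult_right_mono)
      finally show ?thesis by (simp add: Q_def algebra_simps)
    qed
    then have "(norm (x - z))\<^sup>2 \<le> (\<epsilon>\<^sup>2 * Q)\<^sup>2" by (intro power_mono) auto
    ultimately have "2 * (\<epsilon>\<^sup>2 / 60 * (V \<bullet> \<nu>) - \<eta> * E * norm \<nu>) \<le> (\<epsilon>\<^sup>2 * Q)\<^sup>2"
      by (smt (verit))
    moreover have "2 * (\<epsilon>\<^sup>2 / 60 * (V \<bullet> \<nu>) - \<eta> * E * norm \<nu>)
        = \<epsilon>\<^sup>2 * ((V \<bullet> \<nu>) / 30 - 4 * ((e * D + \<epsilon> * (K * w)) * E * norm \<nu>))"
      unfolding \<eta>_def right_diff_distrib by simp
    moreover have "(\<epsilon>\<^sup>2 * Q)\<^sup>2 = \<epsilon>\<^sup>2 * (\<epsilon>\<^sup>2 * Q\<^sup>2)"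
      by (simp add: power2_eq_square)
    ultimately have "\<epsilon>\<^sup>2 * ((V \<bullet> \<nu>) / 30 - 4 * ((e * D + \<epsilon> * (K * w)) * E * norm \<nu>)) \<le> \<epsilon>\<^sup>2 * (\<epsilon>\<^sup>2 * Q\<^sup>2)"
      by simp
    then have "(V \<bullet> \<nu>) / 30 - 4 * ((e * D + \<epsilon> * (K * w)) * E * norm \<nu>) \<le> \<epsilon>\<^sup>2 * Q\<^sup>2"
      using \<epsilon>(1) by (simp only: mult_le_cancel_left_pos zero_less_power)
    then show ?thesis by simp
  qed
  \<comment> \<open>The zeros are left unsimplified so that the right side is visibly the limit of
    the one in \<open>step\<close> as \<epsilon> tends to 0.\<close>
  have eventually_step: "(V \<bullet> \<nu>) / 30 \<le> 4 * ((e * D + 0 * (K * w)) * E * norm \<nu>) + 0\<^sup>2 * Q\<^sup>2"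
    if e: "0 < e" "e \<le> 1" for e
  proof -
    obtain d1 where d1: "d1 > 0" "\<And>y. norm (y - z) < d1 \<Longrightarrow> norm (X y - X z - A (y - z)) \<le> e * norm (y - z)"
      using X_diff e(1) unfolding has_derivative_at_alt by blast
    obtain d2 where d2: "d2 > 0" "\<And>y. norm (y - z) < d2 \<Longrightarrow> norm (Y y - Y z - B (y - z)) \<le> e * norm (y - z)"
      using Y_diff e(1) unfolding has_derivative_at_alt by blast
    \<comment> \<open>The entry \<open>D\<close> in the minimum enforces \<epsilon> \<le> 1; the
      others keep the loop where both linearisations hold and inside the half ball.\<close>
    define m where "m = min (min d1 d2) (min D (R / 2)) / D"
    have m: "m > 0" using d1 d2 D0 R by (simp add: m_def)
    have ev: "\<forall>\<^sub>F \<epsilon> in at_right 0. (V \<bullet> \<nu>) / 30 \<le> 4 * ((e * D + \<epsilon> * (K * w)) * E * norm \<nu>) + \<epsilon>\<^sup>2 * Q\<^sup>2"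
      unfolding eventually_at_right_field
    proof (intro exI conjI allI impI)
      show "m > 0" by fact
      fix \<epsilon> assume \<epsilon>: "0 < \<epsilon>" "\<epsilon> < m"
      then have "\<epsilon> * D < m * D" using D0 by simp
      then have *: "\<epsilon> * D < d1" "\<epsilon> * D < d2" "\<epsilon> * D < R / 2" "\<epsilon> * D < 1 * D"
        using D0 by (auto simp: m_def)
      have "norm (X (z + h) - X z - A h) \<le> e * norm h" "norm (Y (z + h) - Y z - B h) \<le> e * norm h"
        if "norm h \<le> \<epsilon> * D" for h
        using d1(2)[of "z + h"] d2(2)[of "z + h"] that * by auto
      moreover have "\<epsilon> \<le> 1" using *(4) D0 by simp
      ultimately show "(V \<bullet> \<nu>) / 30 \<le> 4 * ((e * D + \<epsilon> * (K * w)) * E * norm \<nu>) + \<epsilon>\<^sup>2 * Q\<^sup>2"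
        using e \<epsilon>(1) *(3) by (intro step) auto
    qed
    show ?thesis
      by (rule tendsto_lowerbound[OF _ ev]) (auto intro!: tendsto_eq_intros)
  qed
  have "(V \<bullet> \<nu>) / 30 \<le> 4 * (0 * D * E * norm \<nu>)"
  proof (rule tendsto_lowerbound)
    show "((\<lambda>e. 4 * (e * D * E * norm \<nu>)) \<longlongrightarrow> 4 * (0 * D * E * norm \<nu>)) (at_right 0)"
      by (intro tendsto_intros)
    show "\<forall>\<^sub>F e in at_right 0. (V \<bullet> \<nu>) / 30 \<le> 4 * (e * D * E * norm \<nu>)"
      unfolding eventually_at_right_field
      by (rule exI[of _ 1]) (use eventually_step in auto)
  qed simp
  then show ?thesis by (simp add: V_def)
qed

subsection \<open>Continuously differentiable fields\<close>

lemma C1_on_has_derivative: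
  "C1_on U f \<Longrightarrow> x \<in> U \<Longrightarrow> (f has_derivative frechet_derivative f (at x)) (at x)"
  by (simp add: C1_on_def frechet_derivative_works[symmetric])

lemma partial_eqI: "(f has_derivative f') (at x) \<Longrightarrow> partial k f x = f' (axis k 1)"
  by (simp add: partial_def frechet_derivative_at[symmetric])

lemma vec_eq_sum_axis: "(\<Sum>k\<in>UNIV. (h $ k) *\<^sub>R axis k (1::real)) = h"
  using basis_expansion[of h] by (simp add: scalar_mult_eq_scaleR)

lemma linear_eq_sum_axis:
  fixes f :: "real^'n \<Rightarrow> 'b::real_vector"
  assumes "linear f"
  shows "f h = (\<Sum>k\<in>UNIV. (h $ k) *\<^sub>R f (axis k 1))"
proof -
  have "f h = f (\<Sum>k\<in>UNIV. (h $ k) *\<^sub>R axis k 1)" by (simp add: vec_eq_sum_axis)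
  then show ?thesis by (simp add: linear_sum[OF assms] linear_cmul[OF assms])
qed

lemma has_derivative_eq_sum_partial:
  assumes "(f has_derivative f') (at x)"
  shows "f' h = (\<Sum>k\<in>UNIV. (h $ k) *\<^sub>R partial k f x)"
  unfolding partial_eqI[OF assms] by (rule linear_eq_sum_axis[OF has_derivative_linear[OF assms]])

lemma has_derivative_grad:
  assumes "u differentiable (at x)"
  shows "(u has_derivative (\<lambda>h. grad u x \<bullet> h)) (at x)"
proof -
  have D: "(u has_derivative frechet_derivative u (at x)) (at x)"
    using assms by (simp add: frechet_derivative_works)
  have "frechet_derivative u (at x) = (\<lambda>h. grad u x \<bullet> h)"
    by (simp add: has_derivative_eq_sum_partial[OF D] fun_eq_iff grad_def inner_vec_def mult.commute)
  then show ?thesis using D by simp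
qed

lemma has_derivative_cartI:
  fixes f :: "'a::real_normed_vector \<Rightarrow> real^'n"
  assumes "\<And>k. ((\<lambda>y. f y $ k) has_derivative (\<lambda>h. f' h $ k)) (at x)"
  shows "(f has_derivative f') (at x)"
  unfolding has_derivative_componentwise_within[of f]
  using assms by (auto simp: Basis_vec_def inner_axis)

lemma C1_on_grad:
  assumes "C2_on U u"
  shows "C1_on U (grad u)"
proof -
  have p: "C1_on U (partial k u)" for k using assms by (simp add: C2_on_def)
  have D: "(grad u has_derivative (\<lambda>h. \<chi> k. frechet_derivative (partial k u) (at x) h)) (at x)"
    if "x \<in> U" for x
    using C1_on_has_derivative[OF p that] by (intro has_derivative_cartI) (simp add: grad_def)
  have "partial j (grad u) x = (\<chi> k. partial j (partial k u) x)" if "x \<in> U" for j x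
    using partial_eqI[OF D[OF that]] by (simp add: partial_def)
  moreover have "continuous_on U (\<lambda>x. \<chi> k. partial j (partial k u) x)" for j
    using p by (intro continuous_on_vec_lambda) (simp add: C1_on_def)
  ultimately show ?thesis
    unfolding C1_on_def using D[THEN differentiableI] by (simp cong: continuous_on_cong_simp)
qed

lemma C1_on_add:
  assumes "C1_on U f" "C1_on U g"
  shows "C1_on U (\<lambda>y. f y + g y)"
proof -
  have D: "((\<lambda>y. f y + g y) has_derivative
      (\<lambda>h. frechet_derivative f (at x) h + frechet_derivative g (at x) h)) (at x)" if "x \<in> U" for x
    using assms that by (intro has_derivative_add C1_on_has_derivative)
  have "partial k (\<lambda>y. f y + g y) x = partial k f x + partial k g x" if "x \<in> U" for k x
    using partial_eqI[OF D[OF that]] by (simp add: partial_def)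
  then show ?thesis
    using assms D[THEN differentiableI] unfolding C1_on_def
    by (simp add: continuous_on_add cong: continuous_on_cong_simp)
qed

lemma C1_on_imp_continuous_on: "C1_on U f \<Longrightarrow> continuous_on U f"
  by (simp add: C1_on_def continuous_at_imp_continuous_on differentiable_imp_continuous_within)

text \<open>Continuity is available for the partial derivatives, so the derivative is dominated by
  the sum of their norms, a continuous function on a compact set.\<close>

lemma C1_on_derivative_bounded:
  assumes f: "C1_on U f" and S: "compact S" "S \<subseteq> U"
  shows "\<exists>K>0. \<forall>x\<in>S. \<forall>h. norm (frechet_derivative f (at x) h) \<le> K * norm h"
proof -
  have "continuous_on S (\<lambda>x. \<Sum>k\<in>UNIV. norm (partial k f x))"
    using f S(2) by (auto simp: C1_on_def intro!: continuous_intros intro: continuous_on_subset)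
  then have "bounded ((\<lambda>x. \<Sum>k\<in>UNIV. norm (partial k f x)) ` S)"
    using S(1) by (intro compact_imp_bounded compact_continuous_image)
  then obtain K where K: "K > 0" "\<And>x. x \<in> S \<Longrightarrow> \<bar>\<Sum>k\<in>UNIV. norm (partial k f x)\<bar> \<le> K"
    by (auto simp: bounded_pos)
  have "norm (frechet_derivative f (at x) h) \<le> K * norm h" if x: "x \<in> S" for x h
  proof -
    have "norm (frechet_derivative f (at x) h) = norm (\<Sum>k\<in>UNIV. (h $ k) *\<^sub>R partial k f x)"
      using C1_on_has_derivative[OF f] x S(2) by (subst has_derivative_eq_sum_partial) auto
    also have "\<dots> \<le> (\<Sum>k\<in>UNIV. norm h * norm (partial k f x))"
      by (rule sum_norm_le) (simp add: mult_right_mono component_le_norm_cart)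
    also have "\<dots> \<le> norm h * K"
      using K(2)[OF x] by (simp add: sum_distrib_left[symmetric] mult_left_mono)
    finally show ?thesis by (simp add: mult.commute)
  qed
  with K(1) show ?thesis by blast
qed

lemma C1_on_lipschitz_cball:
  assumes f: "C1_on U f" and R: "cball z R \<subseteq> U"
  shows "\<exists>L>0. \<forall>x\<in>cball z R. \<forall>y\<in>cball z R. norm (f x - f y) \<le> L * norm (x - y)"
proof -
  obtain K where K: "K > 0" "\<And>x h. x \<in> cball z R \<Longrightarrow> norm (frechet_derivative f (at x) h) \<le> K * norm h"
    using C1_on_derivative_bounded[OF f compact_cball R] by blast
  have "norm (f x - f y) \<le> K * norm (x - y)" if "x \<in> cball z R" "y \<in> cball z R" for x y
  proof (rule differentiable_bound[where S = "cball z R" and f' = "\<lambda>q. frechet_derivative f (at q)"])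
    show "convex (cball z R)" "x \<in> cball z R" "y \<in> cball z R" by (fact convex_cball that)+
    fix q assume q: "q \<in> cball z R"
    show "(f has_derivative frechet_derivative f (at q)) (at q within cball z R)"
      using C1_on_has_derivative[OF f subsetD[OF R q]] by (rule has_derivative_at_withinI)
    show "onorm (frechet_derivative f (at q)) \<le> K" by (rule onorm_le) (rule K(2)[OF q])
  qed
  with K(1) show ?thesis by blast
qed

subsection \<open>The curvature operator and the barrier argument\<close>

text \<open>For a unit vector n and linear M this is the trace of M compressed to the hyperplane
  orthogonal to n, written without choosing a basis of that hyperplane.\<close>

definition trace_perp :: "real^'n \<Rightarrow> (real^'n \<Rightarrow> real^'n) \<Rightarrow> real"
  where "trace_perp n M = (\<Sum>k\<in>UNIV. M (axis k 1) $ k) - n \<bullet> M n"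

text \<open>With P = grad u + F and n = P / |P|, the derivative of P / |P| along h is (M h - (M h .
  n) n) / |P|; the divergence is its trace.\<close>

lemma HF_eq_trace_perp:
  assumes P: "((\<lambda>y. grad u y + F y) has_derivative M) (at x)" and nz: "grad u x + F x \<noteq> 0"
  shows "HF F u x = trace_perp (sgn (grad u x + F x)) M / norm (grad u x + F x)"
proof -
  define p where "p = grad u x + F x"
  have p: "p \<noteq> 0" using nz by (simp add: p_def)
  have "((\<lambda>y. norm (grad u y + F y)) has_derivative (\<lambda>h. M h \<bullet> sgn p)) (at x)"
    by (rule has_derivative_compose[OF P, of norm])
       (use has_derivative_norm[OF p] in \<open>simp add: p_def inner_commute\<close>)
  from Deriv.has_derivative_inverse[OF _ this]
  have "((\<lambda>y. inverse (norm (grad u y + F y))) has_derivative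
      (\<lambda>h. - (inverse (norm p) * (M h \<bullet> sgn p) * inverse (norm p)))) (at x)"
    using p by (simp add: p_def)
  from has_derivative_scaleR[OF this P]
  have "(NF F u has_derivative
      (\<lambda>h. (1 / norm p) *\<^sub>R M h - ((M h \<bullet> sgn p) / (norm p)\<^sup>2) *\<^sub>R p)) (at x)"
    unfolding NF_def[abs_def] by (simp add: p_def[symmetric] power2_eq_square divide_inverse mult_ac)
  then have dk: "((\<lambda>y. NF F u y $ k) has_derivative
      (\<lambda>h. ((1 / norm p) *\<^sub>R M h - ((M h \<bullet> sgn p) / (norm p)\<^sup>2) *\<^sub>R p) $ k)) (at x)" for k
    by (rule bounded_linear.has_derivative[OF bounded_linear_vec_nth])
  have "HF F u x = (\<Sum>k\<in>UNIV. M (axis k 1) $ k / norm p - M (axis k 1) \<bullet> sgn p / (norm p)\<^sup>2 * p $ k)"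
    unfolding HF_def divergence_def partial_eqI[OF dk] by simp
  also have "\<dots> = (\<Sum>k\<in>UNIV. M (axis k 1) $ k) / norm p - (\<Sum>k\<in>UNIV. p $ k *\<^sub>R M (axis k 1)) \<bullet> sgn p / (norm p)\<^sup>2"
    by (simp add: sum_subtractf sum_divide_distrib inner_sum_left mult.commute)
  also have "\<dots> = (\<Sum>k\<in>UNIV. M (axis k 1) $ k) / norm p - M p \<bullet> sgn p / (norm p)\<^sup>2"
    using linear_eq_sum_axis[OF has_derivative_linear[OF P], of p] by simp
  also have "\<dots> = trace_perp (sgn p) M / norm p"
    using p linear_cmul[OF has_derivative_linear[OF P]]
    by (simp add: trace_perp_def sgn_div_norm power2_eq_square inner_commute divide_inverse algebra_simps)
  finally show ?thesis by (simp add: p_def)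
qed

text \<open>Projecting the standard basis to the hyperplane orthogonal to n and summing the
  quadratic form over these vectors gives tr (P M P) = tr M - n . M n, where P is the
  projection.\<close>

lemma trace_perp_nonneg:
  assumes M: "linear M" and pos: "\<And>e. M e \<bullet> e \<ge> 0" and n: "norm n = 1"
  shows "trace_perp n M \<ge> 0"
proof -
  have nn: "n \<bullet> n = 1" using n by (simp add: dot_square_norm)
  have ax: "M (axis k 1 - n $ k *\<^sub>R n) \<bullet> (axis k 1 - n $ k *\<^sub>R n)
      = M (axis k 1) $ k - n $ k * (M n $ k) - (n $ k *\<^sub>R M (axis k 1)) \<bullet> n + (n $ k * n $ k) * (M n \<bullet> n)" for k
    by (simp add: linear_diff[OF M] linear_cmul[OF M] inner_diff_left inner_diff_right inner_axis algebra_simps)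
  have "(\<Sum>k\<in>UNIV. M (axis k 1 - n $ k *\<^sub>R n) \<bullet> (axis k 1 - n $ k *\<^sub>R n))
    = (\<Sum>k\<in>UNIV. M (axis k 1) $ k) - n \<bullet> M n - M n \<bullet> n + (n \<bullet> n) * (M n \<bullet> n)"
    unfolding ax sum.distrib sum_subtractf sum_distrib_right[symmetric] inner_sum_left[symmetric]
      linear_eq_sum_axis[OF M, of n, symmetric]
    by (simp add: inner_vec_def)
  also have "\<dots> = trace_perp n M" by (simp add: trace_perp_def nn)
  finally show ?thesis by (metis (no_types, lifting) pos sum_nonneg)
qed

lemma trace_perp_diff:
  "trace_perp n (\<lambda>h. M h - c *\<^sub>R M' h) = trace_perp n M - c * trace_perp n M'"
  by (simp add: trace_perp_def sum_subtractf sum_distrib_left inner_diff_right algebra_simps)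

lemma trace_perp_bound:
  fixes M :: "real^'n \<Rightarrow> real^'n"
  assumes K: "\<And>h. norm (M h) \<le> K * norm h" and n: "norm n = 1"
  shows "\<bar>trace_perp n M\<bar> \<le> (real CARD('n) + 1) * K"
proof -
  have "\<bar>M (axis k 1) $ k\<bar> \<le> K" for k
    using component_le_norm_cart[of "M (axis k 1)" k] K[of "axis k 1"] by simp
  then have "\<bar>\<Sum>k\<in>UNIV. M (axis k 1) $ k\<bar> \<le> (\<Sum>k\<in>(UNIV::'n set). K)"
    by (intro order_trans[OF sum_abs] sum_mono)
  moreover have "\<bar>n \<bullet> M n\<bar> \<le> K"
    using Cauchy_Schwarz_ineq2[of n "M n"] K[of n] n by simp
  ultimately show ?thesis by (simp add: trace_perp_def algebra_simps)
qed

lemma norm_sgn_diff_le: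
  fixes p q :: "'a::real_normed_vector"
  assumes "p \<noteq> 0" "q \<noteq> 0"
  shows "norm (sgn p - sgn q) \<le> 2 * norm (p - q) / norm q"
proof -
  have "sgn p - sgn q = (1 / norm q) *\<^sub>R (p - q) + ((norm q - norm p) / (norm p * norm q)) *\<^sub>R p"
    using assms by (simp add: sgn_div_norm algebra_simps divide_inverse scaleR_diff_left)
  also have "norm \<dots> \<le> norm (p - q) / norm q + \<bar>norm q - norm p\<bar> / norm q"
    using assms by (intro order_trans[OF norm_triangle_ineq]) (simp add: abs_mult)
  also have "\<dots> \<le> norm (p - q) / norm q + norm (p - q) / norm q"
    using norm_triangle_ineq3[of q p] by (intro add_mono divide_right_mono) (auto simp: norm_minus_commute)
  finally show ?thesis by simp
qed

text \<open>This is the first-order error of replacing the gradient q by p while keeping the same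
  second-order part. In the constant, 4 comes from the two terms in which the unit normal moves, and
  CARD + 1 from the bound on the trace times the relative change of the norm.\<close>

lemma trace_perp_sgn_perturb:
  fixes M :: "real^'n \<Rightarrow> real^'n"
  assumes M: "linear M" "\<And>h. norm (M h) \<le> K * norm h" and K: "K \<ge> 0"
    and pq: "p \<noteq> 0" "c > 0" "norm q \<ge> c"
  shows "trace_perp (sgn p) M - norm p * (trace_perp (sgn q) M / norm q)
    \<le> (real CARD('n) + 5) * K / c * norm (p - q)"
proof -
  have q: "q \<noteq> 0" using pq by auto
  have n: "norm (sgn p) = 1" "norm (sgn q) = 1" using pq q by (auto simp: norm_sgn)
  have "norm (sgn p - sgn q) \<le> 2 * norm (p - q) / norm q" by (rule norm_sgn_diff_le[OF pq(1) q])
  also have "\<dots> \<le> 2 * norm (p - q) / c" using pq by (intro divide_left_mono mult_pos_pos) auto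
  finally have d: "norm (sgn p - sgn q) \<le> 2 * norm (p - q) / c" .
  have "trace_perp (sgn p) M - trace_perp (sgn q) M
      = - ((sgn p - sgn q) \<bullet> M (sgn p)) - sgn q \<bullet> M (sgn p - sgn q)"
    by (simp add: trace_perp_def linear_diff[OF M(1)] inner_diff_left inner_diff_right)
  also have "\<dots> \<le> norm (sgn p - sgn q) * (K * 1) + 1 * (K * norm (sgn p - sgn q))"
  proof -
    have "\<bar>(sgn p - sgn q) \<bullet> M (sgn p)\<bar> \<le> norm (sgn p - sgn q) * (K * 1)"
      using M(2)[of "sgn p"] n by (intro order_trans[OF Cauchy_Schwarz_ineq2] mult_left_mono) auto
    moreover have "\<bar>sgn q \<bullet> M (sgn p - sgn q)\<bar> \<le> 1 * (K * norm (sgn p - sgn q))"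
      using M(2)[of "sgn p - sgn q"] n by (intro order_trans[OF Cauchy_Schwarz_ineq2]) auto
    ultimately show ?thesis by linarith
  qed
  also have "\<dots> = 2 * K * norm (sgn p - sgn q)" by simp
  also have "\<dots> \<le> 2 * K * (2 * norm (p - q) / c)" using d K by (intro mult_left_mono) auto
  finally have 1: "trace_perp (sgn p) M - trace_perp (sgn q) M \<le> 4 * K / c * norm (p - q)" by simp
  have "trace_perp (sgn q) M - norm p * (trace_perp (sgn q) M / norm q)
      = trace_perp (sgn q) M * ((norm q - norm p) / norm q)"
    using q by (simp add: field_simps)
  also have "\<dots> \<le> \<bar>trace_perp (sgn q) M\<bar> * (\<bar>norm q - norm p\<bar> / norm q)"
    using abs_ge_self[of "trace_perp (sgn q) M * ((norm q - norm p) / norm q)"]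
    by (simp only: abs_mult abs_divide abs_norm_cancel)
  also have "\<dots> \<le> ((real CARD('n) + 1) * K) * (norm (p - q) / c)"
    using trace_perp_bound[OF M(2) n(2)] norm_triangle_ineq3[of q p] pq K
    by (intro mult_mono frac_le) (auto simp: norm_minus_commute)
  finally have "trace_perp (sgn q) M - norm p * (trace_perp (sgn q) M / norm q)
    \<le> ((real CARD('n) + 1) * K) * (norm (p - q) / c)" .
  moreover have "(real CARD('n) + 5) * K / c * norm (p - q)
      = 4 * K / c * norm (p - q) + ((real CARD('n) + 1) * K) * (norm (p - q) / c)"
    using pq by (simp add: field_simps)
  ultimately show ?thesis using 1 by linarith
qed

text \<open>M e . e is the derivative at x of the slope of f along e. A negative value would make
  the slope negative just after x, and the mean value theorem would push f below its
  minimum.\<close>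

lemma interior_min_gradient_hessian:
  fixes f :: "'a::euclidean_space \<Rightarrow> real"
  assumes V: "open V" "x \<in> V"
    and f: "\<And>y. y \<in> V \<Longrightarrow> (f has_derivative (\<lambda>h. G y \<bullet> h)) (at y)"
    and G: "(G has_derivative M) (at x)"
    and min: "\<And>y. y \<in> V \<Longrightarrow> f x \<le> f y"
  shows "G x = 0" "M e \<bullet> e \<ge> 0"
proof -
  have "(\<lambda>h. G x \<bullet> h) = (\<lambda>h. 0)"
    using differential_zero_maxmin[OF V(2,1) f[OF V(2)]] min by blast
  then have "G x \<bullet> G x = 0" by meson
  then show G0: "G x = 0" by simp
  show "M e \<bullet> e \<ge> 0"
  proof (rule ccontr)
    assume neg: "\<not> M e \<bullet> e \<ge> 0"
    have "((\<lambda>t. x + t *\<^sub>R e) \<longlongrightarrow> x + 0 *\<^sub>R e) (at 0)" by (intro tendsto_intros)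
    then have "\<forall>\<^sub>F t in at 0. x + t *\<^sub>R e \<in> V" using V by (intro topological_tendstoD) auto
    then obtain r where r: "r > 0" "\<And>t. \<bar>t\<bar> < r \<Longrightarrow> x + t *\<^sub>R e \<in> V"
      using V(2) unfolding eventually_at by (auto simp: dist_real_def) (metis add.right_neutral scale_zero_left)
    have df: "((\<lambda>t. f (x + t *\<^sub>R e)) has_real_derivative G (x + t *\<^sub>R e) \<bullet> e) (at t)" if "\<bar>t\<bar> < r" for t
    proof -
      have "((\<lambda>t. f (x + t *\<^sub>R e)) has_derivative (\<lambda>h. G (x + t *\<^sub>R e) \<bullet> (h *\<^sub>R e))) (at t)"
        by (rule has_derivative_compose[where g = f and f = "\<lambda>t. x + t *\<^sub>R e", OF _ f[OF r(2)[OF that]]])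
           (auto intro!: derivative_eq_intros)
      then show ?thesis
        unfolding has_field_derivative_def by (rule has_derivative_eq_rhs) (auto simp: fun_eq_iff)
    qed
    have "((\<lambda>t. G (x + t *\<^sub>R e)) has_derivative (\<lambda>h. M (h *\<^sub>R e))) (at 0)"
      by (rule has_derivative_compose[where g = G and f = "\<lambda>t. x + t *\<^sub>R e"])
         (use G in \<open>auto intro!: derivative_eq_intros\<close>)
    then have "((\<lambda>t. G (x + t *\<^sub>R e) \<bullet> e) has_derivative (\<lambda>h. M (h *\<^sub>R e) \<bullet> e)) (at 0)"
      by (rule has_derivative_inner_left)
    then have "((\<lambda>t. G (x + t *\<^sub>R e) \<bullet> e) has_real_derivative M e \<bullet> e) (at 0)"
      unfolding has_field_derivative_def
      by (rule has_derivative_eq_rhs) (auto simp: fun_eq_iff linear_cmul[OF has_derivative_linear[OF G]])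
    from DERIV_neg_dec_right[OF this] neg
    obtain d where d: "d > 0" "\<And>t. t > 0 \<Longrightarrow> t < d \<Longrightarrow> G (x + t *\<^sub>R e) \<bullet> e < 0"
      by (auto simp: G0)
    define t where "t = min r d / 2"
    have t: "0 < t" "t < r" "t < d" using r(1) d(1) by (auto simp: t_def)
    obtain s where s: "0 < s" "s < t" "f (x + t *\<^sub>R e) - f (x + 0 *\<^sub>R e) = (t - 0) * (G (x + s *\<^sub>R e) \<bullet> e)"
      using MVT2[OF t(1), of "\<lambda>t. f (x + t *\<^sub>R e)" "\<lambda>t. G (x + t *\<^sub>R e) \<bullet> e"] df t by auto
    have "f (x + t *\<^sub>R e) - f x < 0"
      using s d(2)[of s] t by (simp add: mult_pos_neg)
    then show False using min[OF r(2)[of t]] t by simp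
  qed
qed

section \<open>Gaussian barriers and their trace along a hyperplane\<close>

lemma has_derivative_gauss:
  fixes y0 :: "'a::euclidean_space"
  shows "((\<lambda>y. exp (- k * ((y - y0) \<bullet> (y - y0)))) has_derivative
    (\<lambda>h. ((- 2 * k * exp (- k * ((x - y0) \<bullet> (x - y0)))) *\<^sub>R (x - y0)) \<bullet> h)) (at x)"
  by (rule has_derivative_eq_rhs) (auto intro!: derivative_eq_intros simp: fun_eq_iff inner_commute algebra_simps)

lemma has_derivative_grad_gauss:
  fixes y0 :: "'a::euclidean_space"
  shows "((\<lambda>y. (- 2 * k * exp (- k * ((y - y0) \<bullet> (y - y0)))) *\<^sub>R (y - y0)) has_derivative
    (\<lambda>h. exp (- k * ((x - y0) \<bullet> (x - y0))) *\<^sub>R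
      ((4 * k\<^sup>2 * ((x - y0) \<bullet> h)) *\<^sub>R (x - y0) - (2 * k) *\<^sub>R h))) (at x)"
proof -
  have 1: "((\<lambda>y. - 2 * k * exp (- k * ((y - y0) \<bullet> (y - y0)))) has_derivative
    (\<lambda>h. - 2 * k * (((- 2 * k * exp (- k * ((x - y0) \<bullet> (x - y0)))) *\<^sub>R (x - y0)) \<bullet> h))) (at x)"
    by (intro has_derivative_mult_right has_derivative_gauss)
  have 2: "((\<lambda>y. y - y0) has_derivative (\<lambda>h. h)) (at x)"
    by (auto intro!: derivative_eq_intros)
  have 3: "(- 2 * k * E) *\<^sub>R h + (- 2 * k * (((- 2 * k * E) *\<^sub>R d) \<bullet> h)) *\<^sub>R d
      = E *\<^sub>R ((4 * k\<^sup>2 * (d \<bullet> h)) *\<^sub>R d - (2 * k) *\<^sub>R h)" for E and d h :: 'a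
    by (simp add: power2_eq_square algebra_simps)
  show ?thesis
    by (rule has_derivative_eq_rhs[OF has_derivative_scaleR[OF 1 2]]) (simp only: 3)
qed

text \<open>The coefficient of 4 k^2 is the squared length of the part of d orthogonal to n: for
  large k the trace is positive unless d is parallel to n.\<close>

lemma trace_perp_gauss:
  fixes d :: "real^'n"
  assumes n: "norm n = 1"
  shows "trace_perp n (\<lambda>h. E *\<^sub>R ((4 * k\<^sup>2 * (d \<bullet> h)) *\<^sub>R d - (2 * k) *\<^sub>R h))
    = E * (4 * k\<^sup>2 * (d \<bullet> d - (d \<bullet> n)\<^sup>2) - 2 * k * (real CARD('n) - 1))"
proof -
  have nn: "n \<bullet> n = 1" using n by (simp add: dot_square_norm)
  have "(\<Sum>i\<in>UNIV. (E *\<^sub>R ((4 * k\<^sup>2 * (d \<bullet> axis i 1)) *\<^sub>R d - (2 * k) *\<^sub>R axis i 1)) $ i)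
    = (\<Sum>i\<in>UNIV. E * (4 * k\<^sup>2) * (d $ i * d $ i) - E * (2 * k))"
    by (intro sum.cong refl) (simp add: inner_axis algebra_simps)
  also have "\<dots> = E * (4 * k\<^sup>2) * (d \<bullet> d) - E * (2 * k) * real CARD('n)"
    by (simp add: sum_subtractf sum_distrib_left[symmetric] inner_vec_def)
  finally show ?thesis
    unfolding trace_perp_def
    by (simp add: inner_diff_right nn inner_commute[of n d] power2_eq_square algebra_simps)
qed

lemma continuous_on_sgn_field:
  fixes f :: "'a::topological_space \<Rightarrow> 'b::real_normed_vector"
  assumes "continuous_on U f" "\<And>x. x \<in> U \<Longrightarrow> f x \<noteq> 0"
  shows "continuous_on U (\<lambda>x. sgn (f x))"
  unfolding sgn_div_norm using assms by (intro continuous_intros) auto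

text \<open>At an interior minimum of \<open>u - v\<close> minus a small multiple of a Gaussian, the curvature
  inequality bounds the steepness \<open>k\<close> of the Gaussian.\<close>

lemma interior_min_gauss_bound:
  fixes F :: "real^'n \<Rightarrow> real^'n" and u v :: "real^'n \<Rightarrow> real"
  assumes V: "open V" "x \<in> V" and C1: "C1_on V F" "C2_on V u" "C2_on V v"
    and nz: "grad v x + F x \<noteq> 0" and c: "c > 0" "norm (grad u x + F x) \<ge> c"
    and H: "HF F u x \<le> HF F v x"
    and K: "K \<ge> 0" "\<And>h. norm (frechet_derivative (\<lambda>y. grad u y + F y) (at x) h) \<le> K * norm h"
    and k: "k > 0" and \<epsilon>: "\<epsilon> > 0"
    and min: "\<And>y. y \<in> V \<Longrightarrow> u x - v x - \<epsilon> * exp (- k * ((x - y0) \<bullet> (x - y0)))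
      \<le> u y - v y - \<epsilon> * exp (- k * ((y - y0) \<bullet> (y - y0)))"
  shows "2 * k * ((x - y0) \<bullet> (x - y0) - ((x - y0) \<bullet> sgn (grad v x + F x))\<^sup>2)
    \<le> real CARD('n) - 1 + (real CARD('n) + 5) * K / c * norm (x - y0)"
proof -
  define d where "d = x - y0"
  define E where "E = exp (- k * ((x - y0) \<bullet> (x - y0)))"
  define p where "p = grad v x + F x"
  define q where "q = grad u x + F x"
  define Mu where "Mu = frechet_derivative (\<lambda>y. grad u y + F y) (at x)"
  define Mv where "Mv = frechet_derivative (\<lambda>y. grad v y + F y) (at x)"
  define Mh where "Mh h = E *\<^sub>R ((4 * k\<^sup>2 * (d \<bullet> h)) *\<^sub>R d - (2 * k) *\<^sub>R h)" for h
  have E: "E > 0" by (simp add: E_def)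
  have p: "p \<noteq> 0" using nz by (simp add: p_def)
  have nzu: "grad u x + F x \<noteq> 0" using c by auto
  have n: "norm (sgn p) = 1" using p by (simp add: norm_sgn)
  have Mu: "((\<lambda>y. grad u y + F y) has_derivative Mu) (at x)"
    unfolding Mu_def by (intro C1_on_has_derivative[OF C1_on_add[OF C1_on_grad] V(2)] C1)
  have Mv: "((\<lambda>y. grad v y + F y) has_derivative Mv) (at x)"
    unfolding Mv_def by (intro C1_on_has_derivative[OF C1_on_add[OF C1_on_grad] V(2)] C1)
  have du: "(u has_derivative (\<lambda>h. grad u y \<bullet> h)) (at y)" and dv: "(v has_derivative (\<lambda>h. grad v y \<bullet> h)) (at y)"
    if "y \<in> V" for y
    using C1 that by (auto intro!: has_derivative_grad simp: C2_on_def C1_on_def)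
  let ?h = "\<lambda>y. exp (- k * ((y - y0) \<bullet> (y - y0)))"
  let ?Gh = "\<lambda>y. (- 2 * k * exp (- k * ((y - y0) \<bullet> (y - y0)))) *\<^sub>R (y - y0)"
  let ?f = "\<lambda>y. u y - v y - \<epsilon> * ?h y"
  let ?G = "\<lambda>y. grad u y - grad v y - \<epsilon> *\<^sub>R ?Gh y"
  have f: "(?f has_derivative (\<lambda>h. ?G y \<bullet> h)) (at y)" if "y \<in> V" for y
  proof -
    have "(?f has_derivative (\<lambda>h. grad u y \<bullet> h - grad v y \<bullet> h - \<epsilon> * (?Gh y \<bullet> h))) (at y)"
      by (intro has_derivative_diff has_derivative_mult_right has_derivative_gauss du dv that)
    then show ?thesis by (rule has_derivative_eq_rhs) (simp only: inner_diff_left inner_scaleR_left)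
  qed
  have G: "(?G has_derivative (\<lambda>h. (Mu h - Mv h) - \<epsilon> *\<^sub>R Mh h)) (at x)"
  proof -
    have "((\<lambda>y. ((grad u y + F y) - (grad v y + F y)) - \<epsilon> *\<^sub>R ?Gh y) has_derivative
        (\<lambda>h. (Mu h - Mv h) - \<epsilon> *\<^sub>R Mh h)) (at x)"
      unfolding Mh_def d_def E_def
      by (intro has_derivative_diff has_derivative_scaleR_right has_derivative_grad_gauss Mu Mv)
    then show ?thesis by simp
  qed
  note im = interior_min_gradient_hessian[OF V f G min]
  have "?G x = 0" by (rule im(1))
  \<comment> \<open>The first-order condition at the minimum: the gradient gap carries the factor
    \<epsilon> k E, one power of k less than the leading Hessian term.\<close>
  then have "p - q = (2 * \<epsilon> * k * E) *\<^sub>R d"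
    by (simp add: p_def q_def E_def d_def algebra_simps)
  then have pq: "norm (p - q) = 2 * \<epsilon> * k * E * norm d"
    using \<epsilon> k E by (simp add: abs_mult)
  have "0 \<le> trace_perp (sgn p) (\<lambda>h. (Mu h - Mv h) - \<epsilon> *\<^sub>R Mh h)"
    by (rule trace_perp_nonneg[OF has_derivative_linear[OF G] im(2) n])
  also have "\<dots> = trace_perp (sgn p) (\<lambda>h. Mu h - 1 *\<^sub>R Mv h) - \<epsilon> * trace_perp (sgn p) Mh"
    by (subst trace_perp_diff) simp
  also have "\<dots> = trace_perp (sgn p) Mu - trace_perp (sgn p) Mv - \<epsilon> * trace_perp (sgn p) Mh"
    by (subst trace_perp_diff) simp
  finally have 1: "\<epsilon> * trace_perp (sgn p) Mh \<le> trace_perp (sgn p) Mu - trace_perp (sgn p) Mv" by simp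
  have "trace_perp (sgn q) Mu / norm q \<le> trace_perp (sgn p) Mv / norm p"
    using H unfolding HF_eq_trace_perp[OF Mu nzu] HF_eq_trace_perp[OF Mv nz] p_def q_def .
  \<comment> \<open>Multiplying by \<open>norm p\<close> frees the term of v from its denominator;
    the ratio left on the term of u is absorbed by the perturbation estimate.\<close>
  then have "norm p * (trace_perp (sgn q) Mu / norm q) \<le> norm p * (trace_perp (sgn p) Mv / norm p)"
    by (rule mult_left_mono) simp
  then have 2: "norm p * (trace_perp (sgn q) Mu / norm q) \<le> trace_perp (sgn p) Mv"
    using p by simp
  have 3: "trace_perp (sgn p) Mu - norm p * (trace_perp (sgn q) Mu / norm q)
      \<le> (real CARD('n) + 5) * K / c * norm (p - q)"
    by (rule trace_perp_sgn_perturb[OF has_derivative_linear[OF Mu] _ K(1) p c(1)])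
       (use K(2) c(2) in \<open>auto simp: Mu_def q_def\<close>)
  have "\<epsilon> * trace_perp (sgn p) Mh \<le> (real CARD('n) + 5) * K / c * (2 * \<epsilon> * k * E * norm d)"
    using 1 2 3 unfolding pq by linarith
  moreover have "trace_perp (sgn p) Mh
      = E * (4 * k\<^sup>2 * (d \<bullet> d - (d \<bullet> sgn p)\<^sup>2) - 2 * k * (real CARD('n) - 1))"
    unfolding Mh_def by (rule trace_perp_gauss[OF n])
  \<comment> \<open>Every term contains 2 \<epsilon> k E, so the resulting bound depends neither on
    \<epsilon> nor on the value of the Gaussian.\<close>
  ultimately have "(2 * \<epsilon> * k * E) * (2 * k * (d \<bullet> d - (d \<bullet> sgn p)\<^sup>2) - (real CARD('n) - 1))
      \<le> (2 * \<epsilon> * k * E) * ((real CARD('n) + 5) * K / c * norm d)"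
    by (simp add: power2_eq_square algebra_simps)
  moreover have "2 * \<epsilon> * k * E > 0" using \<epsilon> k E by simp
  ultimately have "2 * k * (d \<bullet> d - (d \<bullet> sgn p)\<^sup>2) - (real CARD('n) - 1)
      \<le> (real CARD('n) + 5) * K / c * norm d"
    by (simp only: mult_le_cancel_left_pos)
  then show ?thesis by (simp add: d_def p_def)
qed

text \<open>The half-size ball tangent at z lies, apart from z, in the open ball that misses Z.
  Contact at a single point gives u - v a positive minimum on compact pieces of it away from
  z.\<close>

lemma proximal_normal_halve:
  assumes "proximal_normal U Z z \<nu>"
  shows "cball (z + \<nu> /\<^sub>R 2) (norm \<nu> / 2) \<inter> Z = {z}" "cball (z + \<nu> /\<^sub>R 2) (norm \<nu> / 2) \<subseteq> U"
proof -
  have close: "norm (x - z - \<nu>) < norm \<nu>"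
    if x: "x \<in> cball (z + \<nu> /\<^sub>R 2) (norm \<nu> / 2)" and xz: "x \<noteq> z" for x
  proof -
    define a where "a = x - z"
    have "norm (a - \<nu> /\<^sub>R 2) \<le> norm \<nu> / 2"
      using x by (simp add: a_def dist_norm norm_minus_commute algebra_simps)
    then have "(norm (a - \<nu> /\<^sub>R 2))\<^sup>2 \<le> (norm \<nu> / 2)\<^sup>2" by (intro power_mono) auto
    then have "a \<bullet> a \<le> a \<bullet> \<nu>"
      by (simp add: power2_norm_eq_inner power_divide inner_diff_left inner_diff_right inner_commute)
    moreover have "a \<bullet> a > 0" using xz by (simp add: a_def)
    moreover have "(norm (a - \<nu>))\<^sup>2 = a \<bullet> a - 2 * (a \<bullet> \<nu>) + (norm \<nu>)\<^sup>2"
      by (simp add: power2_norm_eq_inner inner_diff_left inner_diff_right inner_commute)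
    ultimately have "(norm (a - \<nu>))\<^sup>2 < (norm \<nu>)\<^sup>2" by linarith
    then show ?thesis unfolding a_def by (rule power2_less_imp_less) simp
  qed
  have "x \<notin> Z" "x \<in> cball (z + \<nu>) (norm \<nu>)" if "x \<in> cball (z + \<nu> /\<^sub>R 2) (norm \<nu> / 2)" "x \<noteq> z" for x
    using close[OF that] assms
    by (auto simp: proximal_normal_def dist_norm norm_minus_commute diff_diff_eq disjoint_iff)
  moreover have "z \<in> Z" "z \<in> cball (z + \<nu>) (norm \<nu>)" "z \<in> cball (z + \<nu> /\<^sub>R 2) (norm \<nu> / 2)"
    using assms by (auto simp: proximal_normal_def dist_norm)
  moreover have "cball (z + \<nu>) (norm \<nu>) \<subseteq> U" using assms by (simp add: proximal_normal_def)
  ultimately show "cball (z + \<nu> /\<^sub>R 2) (norm \<nu> / 2) \<inter> Z = {z}" "cball (z + \<nu> /\<^sub>R 2) (norm \<nu> / 2) \<subseteq> U"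
    by blast+
qed

text \<open>A barrier argument of Hopf type: if \<nu> is not parallel to theta, a steep Gaussian
  centred in the half ball forces an interior minimum near z that violates
  \<open>interior_min_gauss_bound\<close>.\<close>

lemma contact_set_proximal_normal:
  fixes F :: "real^'n \<Rightarrow> real^'n" and u v :: "real^'n \<Rightarrow> real"
  assumes U: "open U" and C1: "C1_on U F" "C2_on U u" "C2_on U v"
    and nzu: "\<And>x. x \<in> U \<Longrightarrow> grad u x + F x \<noteq> 0" and nzv: "\<And>x. x \<in> U \<Longrightarrow> grad v x + F x \<noteq> 0"
    and H: "\<And>x. x \<in> U \<Longrightarrow> HF F u x \<le> HF F v x"
    and uv: "\<And>x. x \<in> U \<Longrightarrow> v x \<le> u x"
    and normal: "proximal_normal U {x\<in>U. u x = v x} z \<nu>"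
  shows "\<exists>c. \<nu> = c *\<^sub>R (grad v z + F z)"
proof -
  define n where "n x = sgn (grad v x + F x)" for x
  define y0 where "y0 = z + \<nu> /\<^sub>R 2"
  define r where "r = norm \<nu> / 2"
  \<comment> \<open>Squared length of the part of x - y0 orthogonal to \<open>n x\<close>; at z it
    vanishes exactly when \<nu> is parallel to theta.\<close>
  define a where "a x = (x - y0) \<bullet> (x - y0) - ((x - y0) \<bullet> n x)\<^sup>2" for x
  have z: "z \<in> U" "u z = v z" using normal by (auto simp: proximal_normal_def)
  note half = proximal_normal_halve[OF normal, folded y0_def r_def]
  have C1P: "C1_on U (\<lambda>y. grad u y + F y)" "C1_on U (\<lambda>y. grad v y + F y)"
    by (intro C1_on_add C1_on_grad C1)+
  have ca: "continuous_on U a"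
    unfolding a_def n_def
    by (intro continuous_intros continuous_on_sgn_field C1_on_imp_continuous_on C1P nzv)
  have nn: "n z \<bullet> n z = 1" using nzv[OF z(1)] by (simp add: n_def dot_square_norm norm_sgn)
  have "\<not> a z > 0"
  proof
    assume az: "a z > 0"
    have "\<forall>\<^sub>F x in at z within U. a z / 2 < a x"
      using ca z(1) az by (intro order_tendstoD(1)[where y = "a z"]) (auto simp: continuous_on_def)
    then have "\<forall>\<^sub>F x in at z. a z / 2 < a x" using at_within_open[OF z(1) U] by simp
    then obtain d where d: "d > 0" "\<And>x. x \<noteq> z \<Longrightarrow> dist x z < d \<Longrightarrow> a z / 2 < a x"
      by (auto simp: eventually_at)
    obtain \<rho>1 where \<rho>1: "\<rho>1 > 0" "cball z \<rho>1 \<subseteq> U" using U z(1) open_contains_cball by blast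
    define \<rho> where "\<rho> = min \<rho>1 (d / 2)"
    have \<rho>: "\<rho> > 0" "cball z \<rho> \<subseteq> U" using \<rho>1 d(1) by (auto simp: \<rho>_def)
    have a_lower: "a z / 2 < a x" if "x \<in> cball z \<rho>" for x
      using d(2)[of x] az that d(1) by (cases "x = z") (auto simp: \<rho>_def dist_commute)
    have BU: "ball z \<rho> \<subseteq> U" using \<rho>(2) ball_subset_cball by blast
    obtain K where K: "K > 0"
      "\<forall>x\<in>cball z \<rho>. \<forall>h. norm (frechet_derivative (\<lambda>y. grad u y + F y) (at x) h) \<le> K * norm h"
      using C1_on_derivative_bounded[OF C1P(1) compact_cball \<rho>(2)] by blast
    have "continuous_on (cball z \<rho>) (\<lambda>x. norm (grad u x + F x))"
      using continuous_on_subset[OF C1_on_imp_continuous_on[OF C1P(1)] \<rho>(2)] by (rule continuous_on_norm)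
    then obtain x1 where x1: "x1 \<in> cball z \<rho>"
      "\<And>x. x \<in> cball z \<rho> \<Longrightarrow> norm (grad u x1 + F x1) \<le> norm (grad u x + F x)"
      using continuous_attains_inf[of "cball z \<rho>" "\<lambda>x. norm (grad u x + F x)"] \<rho>(1) by auto
    define c where "c = norm (grad u x1 + F x1)"
    have c: "c > 0" using nzu[of x1] x1(1) \<rho>(2) by (auto simp: c_def)
    \<comment> \<open>Bounds the right side of the barrier inequality on the whole ball before
      \<open>k\<close> and \<open>\<epsilon>\<close> are fixed, as |x - y0| \<le> r +
      \<rho>.\<close>
    define m where "m = real CARD('n) - 1 + (real CARD('n) + 5) * K / c * (r + \<rho>)"
    \<comment> \<open>Chosen so that k (a z) = |m| + a z exceeds m.\<close>
    define k where "k = \<bar>m\<bar> / a z + 1"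
    have k: "k > 0" using az by (simp add: k_def add_nonneg_pos)
    let ?h = "\<lambda>y. exp (- k * ((y - y0) \<bullet> (y - y0)))"
    have cuv: "continuous_on U (\<lambda>x. u x - v x)"
      using C1 by (intro continuous_on_diff C1_on_imp_continuous_on) (auto simp: C2_on_def)
    have zy0: "dist z y0 = r" by (simp add: y0_def r_def dist_norm)
    have dots: "(y - y0) \<bullet> (y - y0) = (dist y y0)\<^sup>2" for y by (simp add: dist_norm dot_square_norm)
    obtain \<epsilon> where \<epsilon>: "\<epsilon> > 0" "\<And>x. x \<in> sphere z \<rho> \<inter> cball y0 r \<Longrightarrow> \<epsilon> \<le> u x - v x"
    proof (cases "sphere z \<rho> \<inter> cball y0 r = {}")
      case True
      then show ?thesis using that[of 1] by auto
    next
      case False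
      have S: "sphere z \<rho> \<inter> cball y0 r \<subseteq> U" using half(2) by blast
      have "compact (sphere z \<rho> \<inter> cball y0 r)" by (intro compact_Int compact_sphere compact_cball)
      then obtain x2 where x2: "x2 \<in> sphere z \<rho> \<inter> cball y0 r"
        "\<And>x. x \<in> sphere z \<rho> \<inter> cball y0 r \<Longrightarrow> u x2 - v x2 \<le> u x - v x"
        using continuous_attains_inf[OF _ False continuous_on_subset[OF cuv S]] by blast
      have "x2 \<noteq> z" using x2(1) \<rho>(1) by auto
      then have "u x2 \<noteq> v x2" using x2(1) S half(1) by blast
      then have "u x2 - v x2 > 0" using uv[of x2] x2(1) S by force
      then show ?thesis using that x2(2) by blast
    qed
    let ?f = "\<lambda>y. u y - v y - \<epsilon> * ?h y"
    have "continuous_on (cball z \<rho>) ?f"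
      by (intro continuous_on_diff[OF continuous_on_subset[OF cuv \<rho>(2)]] continuous_intros)
    then obtain x where x: "x \<in> cball z \<rho>" "\<And>y. y \<in> cball z \<rho> \<Longrightarrow> ?f x \<le> ?f y"
      using continuous_attains_inf[of "cball z \<rho>" ?f] \<rho>(1) by auto
    \<comment> \<open>Inside the half ball the gap u - v is at least \<epsilon> and the Gaussian at
      most 1. Outside, u - v \<ge> 0 and the Gaussian is smaller than at z. Hence the minimum over
      the closed ball is interior.\<close>
    have "?f z < ?f y" if y: "y \<in> sphere z \<rho>" for y
    proof (cases "y \<in> cball y0 r")
      case True
      have "?h y \<le> 1" using k by (simp add: dots)
      then have "\<epsilon> * ?h y \<le> \<epsilon> * 1" using \<epsilon>(1) by (intro mult_left_mono) auto
      then have "?f y \<ge> 0" using \<epsilon>(2)[of y] y True by auto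
      moreover have "?f z < 0" using \<epsilon>(1) z(2) by simp
      ultimately show ?thesis by simp
    next
      case False
      then have "r < dist y y0" by (simp add: dist_commute)
      then have "r\<^sup>2 < (dist y y0)\<^sup>2" by (intro power_strict_mono) (auto simp: r_def)
      then have "?h y < ?h z" using k by (simp add: dots zy0)
      then have "\<epsilon> * ?h y < \<epsilon> * ?h z" using \<epsilon>(1) by simp
      moreover have "y \<in> U" using y \<rho>(2) by auto
      ultimately show ?thesis using uv[of y] z(2) by simp
    qed
    then have "x \<notin> sphere z \<rho>" using x(2)[of z] \<rho>(1) by fastforce
    then have xb: "x \<in> ball z \<rho>" using x(1) by auto
    have xU: "x \<in> U" using xb BU by blast
    have sub: "C1_on (ball z \<rho>) f" if "C1_on U f" for f :: "real^'n \<Rightarrow> 'b::real_normed_vector"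
      using that BU unfolding C1_on_def by (meson continuous_on_subset subsetD)
    have sub2: "C2_on (ball z \<rho>) f" if "C2_on U f" for f :: "real^'n \<Rightarrow> real"
      using that sub unfolding C2_on_def by blast
    have "2 * k * a x \<le> real CARD('n) - 1 + (real CARD('n) + 5) * K / c * norm (x - y0)"
      unfolding a_def n_def
    proof (rule interior_min_gauss_bound[where V = "ball z \<rho>" and u = u and \<epsilon> = \<epsilon>])
      show "C1_on (ball z \<rho>) F" "C2_on (ball z \<rho>) u" "C2_on (ball z \<rho>) v"
        using sub sub2 C1 by auto
      show "c \<le> norm (grad u x + F x)" unfolding c_def by (rule x1(2)[OF x(1)])
      show "norm (frechet_derivative (\<lambda>y. grad u y + F y) (at x) h) \<le> K * norm h" for h
        using K(2) x(1) by blast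
    qed (use xb xU nzv H K c k \<epsilon> x in auto)
    also have "\<dots> \<le> m"
    proof -
      have "norm (x - y0) \<le> \<rho> + r"
        using dist_triangle[of x y0 z] x(1) zy0 by (simp add: dist_norm norm_minus_commute)
      then show ?thesis unfolding m_def using K c by (intro add_left_mono mult_left_mono) auto
    qed
    finally have "2 * k * a x \<le> m" .
    moreover have "2 * k * (a z / 2) < 2 * k * a x" using a_lower[OF x(1)] k by simp
    moreover have "2 * k * (a z / 2) = \<bar>m\<bar> + a z" using az by (simp add: k_def field_simps)
    ultimately show False using az by linarith
  qed
  \<comment> \<open>Since z - y0 = - \<nu> / 2, this is 4 a(z) \<le> 0, the equality case of
    Cauchy-Schwarz.\<close>
  then have "\<nu> \<bullet> \<nu> - (\<nu> \<bullet> n z)\<^sup>2 \<le> 0"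
    by (simp add: a_def y0_def power2_eq_square)
  then have "norm (\<nu> - (\<nu> \<bullet> n z) *\<^sub>R n z) = 0"
    using nn inner_ge_zero[of "\<nu> - (\<nu> \<bullet> n z) *\<^sub>R n z"]
    by (simp add: inner_diff_left inner_diff_right inner_commute power2_eq_square norm_eq_sqrt_inner)
  then have "\<nu> = (\<nu> \<bullet> n z) *\<^sub>R n z" by simp
  then have "\<nu> = ((\<nu> \<bullet> n z) / norm (grad v z + F z)) *\<^sub>R (grad v z + F z)"
    by (simp add: n_def sgn_div_norm divide_inverse)
  then show ?thesis by blast
qed

subsection \<open>Propagation of the contact set\<close>

text \<open>Near a point of Z, the vector to y from its nearest point is a proximal normal; being 0,
  it puts y into Z. Connectedness of U does the rest.\<close>

lemma no_proximal_normals_imp_eq: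
  fixes Z :: "'a::euclidean_space set"
  assumes U: "open U" "connected U" and Z: "closedin (top_of_set U) Z" "Z \<noteq> {}"
    and normal: "\<And>x \<nu>. proximal_normal U Z x \<nu> \<Longrightarrow> \<nu> = 0"
  shows "Z = U"
proof -
  have ZU: "Z \<subseteq> U" using Z(1) by (simp add: closedin_def)
  have "open Z"
    unfolding open_contains_ball
  proof
    fix z assume z: "z \<in> Z"
    then obtain R where R: "R > 0" "cball z R \<subseteq> U" using U(1) ZU open_contains_cball by blast
    have "y \<in> Z" if y: "y \<in> ball z (R / 2)" for y
    proof -
      obtain x where x: "x \<in> Z \<inter> cball z R" "proximal_normal U Z x (y - x)"
        using nearest_point_proximal_normal[OF Z(1) z R(2) y] by blast
      then show ?thesis using normal[OF x(2)] by simp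
    qed
    then show "\<exists>e>0. ball z e \<subseteq> Z" using R(1) by (intro exI[of _ "R / 2"]) auto
  qed
  then have "openin (top_of_set U) Z" using ZU by (simp add: openin_open_eq U(1))
  then show ?thesis using U(2) Z unfolding connected_clopen by blast
qed

text \<open>Exchanging X and Y reverses the sign of the bracket, so the one-sided estimate applies
  twice.\<close>

lemma bracket_proximal_normal:
  fixes X Y :: "real^'n \<Rightarrow> real^'n"
  assumes U: "open U" and Z: "closedin (top_of_set U) Z" and normal: "proximal_normal U Z z \<nu>"
    and X_tan: "\<And>x \<nu>. proximal_normal U Z x \<nu> \<Longrightarrow> X x \<bullet> \<nu> = 0"
    and Y_tan: "\<And>x \<nu>. proximal_normal U Z x \<nu> \<Longrightarrow> Y x \<bullet> \<nu> = 0"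
    and C1: "C1_on U X" "C1_on U Y"
  shows "(frechet_derivative Y (at z) (X z) - frechet_derivative X (at z) (Y z)) \<bullet> \<nu> = 0"
proof -
  have z: "z \<in> U" using normal Z by (auto simp: proximal_normal_def closedin_def)
  obtain R where R: "R > 0" "cball z R \<subseteq> U" using U z open_contains_cball by blast
  obtain L1 where L1: "L1 > 0" "\<forall>x\<in>cball z R. \<forall>y\<in>cball z R. norm (X x - X y) \<le> L1 * norm (x - y)"
    using C1_on_lipschitz_cball[OF C1(1) R(2)] by blast
  obtain L2 where L2: "L2 > 0" "\<forall>x\<in>cball z R. \<forall>y\<in>cball z R. norm (Y x - Y y) \<le> L2 * norm (x - y)"
    using C1_on_lipschitz_cball[OF C1(2) R(2)] by blast
  have L: "norm (X x - X y) \<le> (L1 + L2) * norm (x - y)" "norm (Y x - Y y) \<le> (L1 + L2) * norm (x - y)"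
    if "x \<in> cball z R" "y \<in> cball z R" for x y
    using L1 L2 that by (simp_all add: distrib_right add_increasing add_increasing2)
  have L0: "L1 + L2 \<ge> 0" using L1 L2 by simp
  note D = C1_on_has_derivative[OF C1(1) z] C1_on_has_derivative[OF C1(2) z]
  have "(frechet_derivative Y (at z) (X z) - frechet_derivative X (at z) (Y z)) \<bullet> \<nu> \<le> 0"
    by (rule bracket_proximal_normal_nonpos[OF Z normal X_tan Y_tan D R L0 L])
  moreover have "(frechet_derivative X (at z) (Y z) - frechet_derivative Y (at z) (X z)) \<bullet> \<nu> \<le> 0"
    by (rule bracket_proximal_normal_nonpos[OF Z normal Y_tan X_tan D(2,1) R L0 L(2,1)])
  ultimately show ?thesis by (simp add: inner_diff_left)
qed

text \<open>The right side is dF(X, Y), with F read as a one-form. Its double sum has no diagonal,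
  and the parts above and below the diagonal fold into the sum over k < j.\<close>

lemma curl_pairing_eq:
  fixes F :: "real^'n::{finite,linorder} \<Rightarrow> real^'n::_"
  assumes F: "(F has_derivative F') (at x)"
  shows "curl_pairing F X Y x = F' (X x) \<bullet> Y x - F' (Y x) \<bullet> X x"
proof -
  define D where "D k j = F' (axis k 1) $ j" for k j
  define g where "g k j = (D k j - D j k) * (X x $ k * Y x $ j)" for k j
  have part: "partial k (\<lambda>y. F y $ j) x = D k j" for k j
    unfolding D_def by (rule partial_eqI) (rule bounded_linear.has_derivative[OF bounded_linear_vec_nth F])
  have pair: "F' a \<bullet> c = (\<Sum>k\<in>UNIV. \<Sum>j\<in>UNIV. D k j * (a $ k * c $ j))" for a c
    unfolding linear_eq_sum_axis[OF has_derivative_linear[OF F], of a] inner_sum_left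
    by (simp add: D_def inner_vec_def sum_distrib_left mult_ac)
  have "F' (Y x) \<bullet> X x = (\<Sum>k\<in>UNIV. \<Sum>j\<in>UNIV. D j k * (X x $ k * Y x $ j))"
    unfolding pair by (subst sum.swap) (simp add: mult_ac)
  then have "F' (X x) \<bullet> Y x - F' (Y x) \<bullet> X x = (\<Sum>k\<in>UNIV. \<Sum>j\<in>UNIV. g k j)"
    unfolding pair[of "X x"] by (simp add: g_def sum_subtractf[symmetric] left_diff_distrib)
  also have "\<dots> = (\<Sum>(k, j)\<in>UNIV. g k j)"
    by (simp add: sum.cartesian_product)
  also have "\<dots> = (\<Sum>(k, j)\<in>{(k, j). k < j} \<union> {(k, j). j < k}. g k j)"
    by (rule sum.mono_neutral_right) (auto simp: g_def not_less_iff_gr_or_eq)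
  also have "\<dots> = (\<Sum>(k, j)\<in>{(k, j). k < j}. g k j) + (\<Sum>(k, j)\<in>{(k, j). j < k}. g k j)"
    by (rule sum.union_disjoint) auto
  also have "(\<Sum>(k, j)\<in>{(k, j). j < k}. g k j) = (\<Sum>(k, j)\<in>{(k, j). k < j}. g j k)"
    by (rule sum.reindex_bij_witness[of _ prod.swap prod.swap]) auto
  also have "(\<Sum>(k, j)\<in>{(k, j). k < j}. g k j) + (\<Sum>(k, j)\<in>{(k, j). k < j}. g j k) = curl_pairing F X Y x"
    unfolding curl_pairing_def part sum.distrib[symmetric]
    by (rule sum.cong) (auto simp: g_def algebra_simps)
  finally show ?thesis by simp
qed

text \<open>With the one-form \<open>\<theta> = dw + F\<close>, this is \<open>\<theta>([X, Y]) = - d\<theta>(X, Y)\<close> for \<open>X\<close>, \<open>Y\<close> in the kernel of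
  \<open>\<theta>\<close>, and \<open>d\<theta> = dF\<close>.\<close>

lemma bracket_inner_eq_curl_pairing:
  fixes F :: "real^'n::{finite,linorder} \<Rightarrow> real^'n::_"
  assumes U: "open U" "z \<in> U" and C1: "C1_on U F" "C2_on U w" "C1_on U X" "C1_on U Y"
    and X: "\<And>x. x \<in> U \<Longrightarrow> X x \<bullet> (grad w x + F x) = 0"
    and Y: "\<And>x. x \<in> U \<Longrightarrow> Y x \<bullet> (grad w x + F x) = 0"
  shows "(frechet_derivative Y (at z) (X z) - frechet_derivative X (at z) (Y z)) \<bullet> (grad w z + F z)
    = - curl_pairing F X Y z"
proof -
  define H where "H = frechet_derivative (grad w) (at z)"
  define F' where "F' = frechet_derivative F (at z)"
  have H: "(grad w has_derivative H) (at z)"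
    unfolding H_def by (rule C1_on_has_derivative[OF C1_on_grad[OF C1(2)] U(2)])
  have F': "(F has_derivative F') (at z)"
    unfolding F'_def by (rule C1_on_has_derivative[OF C1(1) U(2)])
  \<comment> \<open>Obtained by differentiating V . theta = 0; it trades the derivative of V for
    that of theta.\<close>
  have ann: "V' h \<bullet> (grad w z + F z) = - (V z \<bullet> (H h + F' h))"
    if V: "\<And>x. x \<in> U \<Longrightarrow> V x \<bullet> (grad w x + F x) = 0" "(V has_derivative V') (at z)" for V V' h
  proof -
    have "((\<lambda>x. V x \<bullet> (grad w x + F x)) has_derivative
        (\<lambda>h. V z \<bullet> (H h + F' h) + V' h \<bullet> (grad w z + F z))) (at z)"
      by (intro has_derivative_inner has_derivative_add V(2) H F')
    moreover have "((\<lambda>x. V x \<bullet> (grad w x + F x)) has_derivative (\<lambda>h. 0)) (at z)"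
      by (rule has_derivative_transform_within_open[OF has_derivative_const U]) (use V(1) in simp)
    ultimately have "(\<lambda>h. V z \<bullet> (H h + F' h) + V' h \<bullet> (grad w z + F z)) = (\<lambda>h. 0)"
      by (rule has_derivative_unique)
    then have "V z \<bullet> (H h + F' h) + V' h \<bullet> (grad w z + F z) = 0" by meson
    then show ?thesis by simp
  qed
  \<comment> \<open>By this symmetry the second derivatives of w cancel in the bracket, leaving the
    derivative of F alone.\<close>
  have "H (X z) \<bullet> Y z = H (Y z) \<bullet> X z"
  proof (rule hessian_symmetric[OF U _ H])
    show "(w has_derivative (\<lambda>h. grad w y \<bullet> h)) (at y)" if "y \<in> U" for y
      using C1(2) that by (auto intro!: has_derivative_grad simp: C2_on_def C1_on_def)
  qed
  then show ?thesis
    using ann[OF X C1_on_has_derivative[OF C1(3) U(2)], of "Y z"]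
      ann[OF Y C1_on_has_derivative[OF C1(4) U(2)], of "X z"]
    by (simp add: curl_pairing_eq[OF F'] inner_diff_left inner_diff_right inner_add_right inner_commute)
qed

text \<open>The difference u - v has a minimum at z. This lets the normals, found parallel to grad v
  + F, be compared with the basis even when w = u.\<close>

lemma grad_eq_at_contact:
  fixes u v :: "real^'n \<Rightarrow> real"
  assumes U: "open U" "z \<in> U" and d: "u differentiable (at z)" "v differentiable (at z)"
    and uv: "\<And>x. x \<in> U \<Longrightarrow> v x \<le> u x" and z: "u z = v z"
  shows "grad u z = grad v z"
proof -
  have "((\<lambda>x. u x - v x) has_derivative (\<lambda>h. grad u z \<bullet> h - grad v z \<bullet> h)) (at z)"
    by (intro has_derivative_diff has_derivative_grad d)
  from differential_zero_maxmin[OF U(2,1) this]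
  have "(\<lambda>h. grad u z \<bullet> h - grad v z \<bullet> h) = (\<lambda>h. 0)" using uv z by simp
  then have "grad u z \<bullet> (grad u z - grad v z) - grad v z \<bullet> (grad u z - grad v z) = 0" by meson
  then show ?thesis by (simp add: inner_diff_left[symmetric])
qed

theorem corollaryG:
  fixes U :: "(real^'n::{finite,linorder}) set"
    and F :: "real^'n::_ \<Rightarrow> real^'n::_"
    and u v w :: "real^'n::_ \<Rightarrow> real"
    and b :: "nat \<Rightarrow> real^'n::_ \<Rightarrow> real^'n::_"
    and p0 :: "real^'n::_"
  assumes "CARD('n) \<ge> 3"
    and "open U" "connected U"
    and "C1_on U F" "C2_on U u" "C2_on U v"
    and "\<forall>x\<in>U. grad u x + F x \<noteq> 0" "\<forall>x\<in>U. grad v x + F x \<noteq> 0"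
    and "\<forall>x\<in>U. HF F u x \<le> HF F v x"
    and "\<forall>x\<in>U. u x \<ge> v x"
    and "p0 \<in> U" "u p0 = v p0"
    and "w = v \<or> w = u"
    and "\<forall>\<alpha>\<in>{1..CARD('n) - 1}. C1_on U (b \<alpha>)"
    and "orthonormal_basis_of_perp U (NF F w) b"
    and "\<exists>\<alpha>\<in>{1..CARD('n) - 1}. \<exists>\<beta>\<in>{1..CARD('n) - 1}. \<alpha> \<noteq> \<beta> \<and>
           (\<forall>x\<in>U. curl_pairing F (b \<alpha>) (b \<beta>) x \<noteq> 0)"
  shows "\<forall>x\<in>U. u x = v x"
proof -
  obtain \<alpha> \<beta> where \<alpha>\<beta>: "\<alpha> \<in> {1..CARD('n) - 1}" "\<beta> \<in> {1..CARD('n) - 1}"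
    "\<And>x. x \<in> U \<Longrightarrow> curl_pairing F (b \<alpha>) (b \<beta>) x \<noteq> 0"
    using assms(16) by blast
  define Z where "Z = {x\<in>U. u x = v x}"
  define \<theta> where "\<theta> x = grad w x + F x" for x
  have C1uv: "C1_on U u" "C1_on U v" using assms(5,6) by (auto simp: C2_on_def)
  have C2w: "C2_on U w" using assms(5,6,13) by blast
  have perp: "b \<gamma> x \<bullet> \<theta> x = 0" if "\<gamma> \<in> {1..CARD('n) - 1}" "x \<in> U" for \<gamma> x
  proof -
    have "b \<gamma> x \<in> span ((\<lambda>\<alpha>. b \<alpha> x) ` {1..CARD('n) - 1})"
      using that(1) by (intro span_base) blast
    then have "b \<gamma> x \<bullet> NF F w x = 0"
      using assms(15) that(2) unfolding orthonormal_basis_of_perp_def by blast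
    moreover have "\<theta> x \<noteq> 0" using assms(7,8,13) that(2) by (auto simp: \<theta>_def)
    ultimately show ?thesis by (simp add: NF_def \<theta>_def)
  qed
  have parallel: "\<exists>c. \<nu> = c *\<^sub>R \<theta> z" if "proximal_normal U Z z \<nu>" for z \<nu>
  proof -
    have z: "z \<in> U" "u z = v z" using that by (auto simp: proximal_normal_def Z_def)
    have "grad u z = grad v z"
      using C1uv z assms(10) by (intro grad_eq_at_contact[OF assms(2) z(1)]) (auto simp: C1_on_def)
    then have "\<theta> z = grad v z + F z" using assms(13) by (auto simp: \<theta>_def)
    then show ?thesis
      using contact_set_proximal_normal[OF assms(2,4,5,6) _ _ _ _ that[unfolded Z_def]] assms(7-10) by auto
  qed
  have tangent: "b \<gamma> x \<bullet> \<nu> = 0"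
    if "\<gamma> \<in> {1..CARD('n) - 1}" "proximal_normal U Z x \<nu>" for \<gamma> x \<nu>
    using parallel[OF that(2)] perp[OF that(1), of x] that(2)
    by (auto simp: proximal_normal_def Z_def)
  have "closedin (top_of_set U) Z"
  proof -
    have "continuous_on U (\<lambda>x. u x - v x)"
      by (intro continuous_on_diff C1_on_imp_continuous_on C1uv)
    then have "closedin (top_of_set U) (U \<inter> (\<lambda>x. u x - v x) -` {0})"
      by (rule continuous_closedin_preimage) simp
    moreover have "U \<inter> (\<lambda>x. u x - v x) -` {0} = Z" by (auto simp: Z_def)
    ultimately show ?thesis by simp
  qed
  note Z = this
  have "Z = U"
  proof (rule no_proximal_normals_imp_eq[OF assms(2,3) Z])
    show "Z \<noteq> {}" using assms(11,12) by (auto simp: Z_def)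
    fix z \<nu> assume normal: "proximal_normal U Z z \<nu>"
    then have z: "z \<in> U" by (simp add: proximal_normal_def Z_def)
    have C1b: "C1_on U (b \<alpha>)" "C1_on U (b \<beta>)" using assms(14) \<alpha>\<beta> by auto
    obtain c where c: "\<nu> = c *\<^sub>R \<theta> z" using parallel[OF normal] by blast
    have "(frechet_derivative (b \<beta>) (at z) (b \<alpha> z) - frechet_derivative (b \<alpha>) (at z) (b \<beta> z)) \<bullet> \<nu> = 0"
      by (rule bracket_proximal_normal[OF assms(2) Z normal tangent[OF \<alpha>\<beta>(1)] tangent[OF \<alpha>\<beta>(2)] C1b])
    moreover have "(frechet_derivative (b \<beta>) (at z) (b \<alpha> z) - frechet_derivative (b \<alpha>) (at z) (b \<beta> z)) \<bullet> \<theta> z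
        = - curl_pairing F (b \<alpha>) (b \<beta>) z"
      unfolding \<theta>_def
      by (rule bracket_inner_eq_curl_pairing[OF assms(2) z assms(4) C2w C1b])
         (use perp \<alpha>\<beta> in \<open>auto simp: \<theta>_def\<close>)
    \<comment> \<open>The bracket is orthogonal to \<nu> = c \<theta>, while its product with
      \<theta> is a nonzero curl, so c must vanish.\<close>
    ultimately have "c * curl_pairing F (b \<alpha>) (b \<beta>) z = 0" by (simp add: c)
    then show "\<nu> = 0" using \<alpha>\<beta>(3)[OF z] by (simp add: c)
  qed
  then show ?thesis by (auto simp: Z_def)
qed

end
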